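(* Let $p$ be a prime. If $A=\prod^{(\aleph_1)}_{\alpha<\aleph_1}E_{\alpha+1}$, then $S(A)$ is local and $\lambda$-complete for any limit ordinal $\lambda\neq\aleph_1$, but not $\aleph_1$-complete.
   Context: An inverse sequence of abelian groups $S$ consists of abelian groups $S_i$ and homomorphisms $f_i:S_{i+1}\to S_i$, $i\in\omega=\{0,1,2,\dots\}$. $\lim S$ and $\lim^1S$ are the kernel and the cokernel of $1-F:\prod_iS_i\to\prod_iS_i$, $\mathrm{pr}_jF=f_j\mathrm{pr}_{j+1}$. $S$ is local if $\lim S=\lim^1S=0$. Let $I(S)\subseteq S$ be given by $I(S)_i=\mathrm{Im}(f_i:S_{i+1}\to S_i)$; put $I^0(S)=S$, $I^{\beta+1}(S)=I(I^\beta(S))$, and $I^\lambda(S)=\lim_{\beta<\lambda}I^\beta(S)$ (the componentwise intersection) for a limit ordinal $\lambda$. Put $S^\beta=S/I^\beta(S)$, and for a limit ordinal $\lambda$ put $\widehat S^\lambda=\lim_{\beta<\lambda}S^\beta$ (componentwise limit). $S$ is $\lambda$-complete if the natural map $S\to\widehat S^\lambda$ is an epimorphism (componentwise surjective). Cardinals are identified with initial ordinals, so $\aleph_1$ is the first uncountable ordinal. For an abelian group $A$: $S(A)$ is the inverse sequence with $S(A)_i=A$ and $f_i(a)=pa$ for all $i$. Also $p^0A=A$, $p^{\beta+1}A=p\cdot(p^\beta A)$, and $p^\lambda A=\bigcap_{\beta<\lambda}p^\beta A$ for a limit ordinal $\lambda$. For a family of abelian groups $(A_x)_{x\in X}$,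 the $\aleph_1$-supported product $\prod^{(\aleph_1)}_{x\in X}A_x$ is the subgroup of $\prod_{x\in X}A_x$ of elements whose support has cardinality $<\aleph_1$. Construction of $E_\alpha$ for an ordinal $\alpha$: let $\alpha^\diamond$ be the set of all finite increasing sequences of ordinals $(\alpha_1,\dots,\alpha_n)$ with $\alpha_1<\dots<\alpha_n<\alpha$, $n\ge1$. Let $\mathbb{Z}_p$ be the $p$-adic integers, $P_\alpha=\prod_{\sigma\in\alpha^\diamond}\mathbb{Z}_p$ and $P'_\alpha=\bigoplus_{\sigma\in\alpha^\diamond}\mathbb{Z}_p\subseteq P_\alpha$, with standard basis $(e_\sigma)_{\sigma\in\alpha^\diamond}$ of $P'_\alpha$ over $\mathbb{Z}_p$. Let $R_\alpha\subseteq P'_\alpha$ be the $\mathbb{Z}_p$-submodule generated by the elements $r_{\alpha_1}=pe_{\alpha_1}$ and $r_{\alpha_1,\dots,\alpha_n}=pe_{\alpha_1,\dots,\alpha_n}-e_{\alpha_2,\dots,\alpha_n}$ for $n\ge2$. Put $D_\alpha=P_\alpha/R_\alpha$ and $E_\alpha=D_\alpha/p^\alpha D_\alpha$. *)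

theory Defs
  imports "HOL-Algebra.Algebra"
begin

unbundle cardinal_syntax

section \<open>Ordinals and transfinite iteration\<close>

text \<open>
  An ordinal is represented by a well-order relation \<open>r\<close>; the ordinals below it are the elements
  of \<open>Field r\<close>, and equality of ordinals is the order isomorphism \<open>=o\<close>.  The ordinal zero is not
  counted as a limit ordinal.
\<close>

definition limit_ordinal :: "'o rel \<Rightarrow> bool" where
  "limit_ordinal r \<longleftrightarrow>
     Well_order r \<and> Field r \<noteq> {} \<and> (\<forall>a\<in>Field r. \<exists>b\<in>Field r. (a, b) \<in> r \<and> a \<noteq> b)"

text \<open>The cardinal \<open>cardSuc natLeq\<close> is an initial ordinal with field in \<^typ>\<open>nat set\<close>.\<close>

abbreviation aleph1 :: "nat set rel" where
  "aleph1 \<equiv> cardSuc natLeq"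

abbreviation ord_suc :: "'o rel \<Rightarrow> 'o \<Rightarrow> 'o" where
  "ord_suc r a \<equiv> wo_rel.suc r {a}"

definition is_suc_of :: "'o rel \<Rightarrow> 'o \<Rightarrow> 'o \<Rightarrow> bool" where
  "is_suc_of r a b \<longleftrightarrow> b \<in> underS r a \<and> a = ord_suc r b"

definition trans_iter :: "'o rel \<Rightarrow> ('x \<Rightarrow> 'x) \<Rightarrow> 'x \<Rightarrow> 'o \<Rightarrow> 'x::complete_lattice" where
  "trans_iter r F T = wo_rel.worec r (\<lambda>h a.
     if underS r a = {} then T
     else if \<exists>b. is_suc_of r a b then F (h (THE b. is_suc_of r a b))
     else (INF b\<in>underS r a. h b))"


context
  fixes r :: "'o rel"
  assumes wo: "Well_order r"
begin

lemma is_suc_of_unique: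
  assumes b: "is_suc_of r a b" and c: "is_suc_of r a c"
  shows "b = c"
proof -
  interpret wo_rel r by (rule wo_rel.intro) (rule wo)
  have F: "b \<in> Field r" "c \<in> Field r"
    using b c by (auto simp: is_suc_of_def underS_def Field_def)
  have *: "(y, x) \<in> r" if "is_suc_of r a x" "is_suc_of r a y" "x \<in> Field r" "y \<in> Field r" for x y
  proof (rule ccontr)
    assume n: "(y, x) \<notin> r"
    then have "(x, y) \<in> r" "x \<noteq> y"
      using TOTALS REFL that by (auto simp: refl_on_def)
    then have "(suc {x}, y) \<in> r"
      using suc_least[of "{x}" y] that by auto
    then show False
      using that ANTISYM by (auto simp: is_suc_of_def underS_def antisym_def)
  qed
  show ?thesis
    using *[OF b c F] *[OF c b F(2,1)] ANTISYM by (auto simp: antisym_def)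
qed

lemma trans_iter_unfold:
  fixes F :: "'x::complete_lattice \<Rightarrow> 'x"
  shows "trans_iter r F T a =
     (if underS r a = {} then T
      else if \<exists>b. is_suc_of r a b then F (trans_iter r F T (THE b. is_suc_of r a b))
      else (INF b\<in>underS r a. trans_iter r F T b))"
proof -
  interpret wo_rel r by (rule wo_rel.intro) (rule wo)
  have "adm_wo (\<lambda>h a. if underS a = {} then T
     else if \<exists>b. is_suc_of r a b then F (h (THE b. is_suc_of r a b))
     else (INF b\<in>underS a. h b))"
    unfolding adm_wo_def
  proof (intro allI impI)
    fix f g :: "'o \<Rightarrow> 'x" and x
    assume eq: "\<forall>y\<in>underS x. f y = g y"
    have "f (THE b. is_suc_of r x b) = g (THE b. is_suc_of r x b)" if "is_suc_of r x b" for b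
      using eq that is_suc_of_unique[OF that]
      by (metis is_suc_of_def the_equality)
    moreover have "(INF b\<in>underS x. f b) = (INF b\<in>underS x. g b)"
      using eq by (intro INF_cong) auto
    ultimately show "(if underS x = {} then T
     else if \<exists>b. is_suc_of r x b then F (f (THE b. is_suc_of r x b))
     else (INF b\<in>underS x. f b)) = (if underS x = {} then T
     else if \<exists>b. is_suc_of r x b then F (g (THE b. is_suc_of r x b))
     else (INF b\<in>underS x. g b))" by auto
  qed
  from fun_cong[OF worec_fixpoint[OF this], of a] show ?thesis
    by (simp only: trans_iter_def)
qed

lemma trans_iter_zero: "underS r a = {} \<Longrightarrow> trans_iter r F T a = T"
  by (subst trans_iter_unfold) simp

lemma trans_iter_suc:
  assumes "b \<in> Field r" "aboveS r b \<noteq> {}"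
  shows "trans_iter r F T (ord_suc r b) = F (trans_iter r F T b)"
proof -
  interpret wo_rel r by (rule wo_rel.intro) (rule wo)
  have "AboveS {b} \<noteq> {}"
    using assms by (auto simp: AboveS_def aboveS_def Field_def)
  then have "is_suc_of r (suc {b}) b"
    using suc_greater[of "{b}" b] assms by (auto simp: is_suc_of_def underS_def)
  then have "underS (suc {b}) \<noteq> {}" "\<exists>c. is_suc_of r (suc {b}) c"
      "(THE c. is_suc_of r (suc {b}) c) = b"
    using is_suc_of_unique by (auto simp: is_suc_of_def)
  then show ?thesis
    by (subst trans_iter_unfold) simp
qed

lemma trans_iter_limit:
  assumes "underS r a \<noteq> {}" "\<nexists>b. is_suc_of r a b"
  shows "trans_iter r F T a = (INF b\<in>underS r a. trans_iter r F T b)"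
  unfolding trans_iter_unfold[of F T a] if_not_P[OF assms(1)] if_not_P[OF assms(2)] ..

lemma trans_iter_induct:
  assumes "P T" "\<And>x. P x \<Longrightarrow> P (F x)"
    and "\<And>B. B \<noteq> {} \<Longrightarrow> (\<And>x. x \<in> B \<Longrightarrow> P x) \<Longrightarrow> P (Inf B)"
  shows "P (trans_iter r F T a)"
proof -
  interpret wo_rel r by (rule wo_rel.intro) (rule wo)
  show ?thesis
  proof (induction a rule: well_order_induct)
    case (1 x)
    show ?case
    proof (cases "underS x = {}")
      case True then show ?thesis using assms(1) by (simp add: trans_iter_zero)
    next
      case ne: False
      show ?thesis
      proof (cases "\<exists>b. is_suc_of r x b")
        case True
        then obtain b where b: "is_suc_of r x b" by blast
        then have "(THE b. is_suc_of r x b) = b" using is_suc_of_unique by blast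
        moreover have "P (trans_iter r F T b)" using 1 b by (auto simp: is_suc_of_def underS_def)
        ultimately show ?thesis using ne True assms(2) by (subst trans_iter_unfold) simp
      next
        case False
        then show ?thesis using ne 1
          by (subst trans_iter_limit) (auto intro!: assms(3) simp: underS_def)
      qed
    qed
  qed
qed

end


section \<open>Inverse sequences\<close>

text \<open>
  Abelian groups are written multiplicatively, as in the quotients and products of \<open>HOL-Algebra\<close>;
  in particular \<open>p a\<close> is rendered as \<open>a [^] p\<close>.
\<close>

record 'g inv_seq =
  grp :: "nat \<Rightarrow> 'g monoid"
  bond :: "nat \<Rightarrow> 'g \<Rightarrow> 'g"

definition inverse_sequence :: "'g inv_seq \<Rightarrow> bool" where
  "inverse_sequence S \<longleftrightarrow>
     (\<forall>i. comm_group (grp S i) \<and> bond S i \<in> hom (grp S (Suc i)) (grp S i))"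

abbreviation seq_prod :: "'g inv_seq \<Rightarrow> (nat \<Rightarrow> 'g) monoid" where
  "seq_prod S \<equiv> product_group UNIV (grp S)"

definition shift :: "'g inv_seq \<Rightarrow> (nat \<Rightarrow> 'g) \<Rightarrow> (nat \<Rightarrow> 'g)" where
  "shift S x = (\<lambda>j. bond S j (x (Suc j)))"

definition one_minus_shift :: "'g inv_seq \<Rightarrow> (nat \<Rightarrow> 'g) \<Rightarrow> (nat \<Rightarrow> 'g)" where
  "one_minus_shift S x = x \<otimes>\<^bsub>seq_prod S\<^esub> inv\<^bsub>seq_prod S\<^esub> (shift S x)"

definition inv_lim :: "'g inv_seq \<Rightarrow> (nat \<Rightarrow> 'g) monoid" where
  "inv_lim S = (seq_prod S)\<lparr>carrier := kernel (seq_prod S) (seq_prod S) (one_minus_shift S)\<rparr>"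

definition inv_lim1 :: "'g inv_seq \<Rightarrow> (nat \<Rightarrow> 'g) set monoid" where
  "inv_lim1 S = seq_prod S Mod (one_minus_shift S ` carrier (seq_prod S))"

definition local_seq :: "'g inv_seq \<Rightarrow> bool" where
  "local_seq S \<longleftrightarrow> trivial_group (inv_lim S) \<and> trivial_group (inv_lim1 S)"

text \<open>
  Subsequences of \<open>S\<close> are given by their families of carriers; the transfinite iteration takes
  place in the complete lattice of such families, where infima are componentwise intersections.
\<close>

definition image_seq :: "'g inv_seq \<Rightarrow> (nat \<Rightarrow> 'g set) \<Rightarrow> (nat \<Rightarrow> 'g set)" where
  "image_seq S T = (\<lambda>i. bond S i ` T (Suc i))"

definition iter_image :: "'o rel \<Rightarrow> 'g inv_seq \<Rightarrow> 'o \<Rightarrow> nat \<Rightarrow> 'g set" where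
  "iter_image r S = trans_iter r (image_seq S) (\<lambda>i. carrier (grp S i))"

definition quot_seq :: "'o rel \<Rightarrow> 'g inv_seq \<Rightarrow> 'o \<Rightarrow> nat \<Rightarrow> 'g set monoid" where
  "quot_seq r S b i = grp S i Mod iter_image r S b i"

text \<open>
  For \<open>b \<le> c\<close> the projection of \<open>S / I\<^sup>c(S)\<close> onto \<open>S / I\<^sup>b(S)\<close> sends a coset \<open>C\<close> to
  the coset \<open>I\<^sup>b(S) C\<close>.
\<close>

definition completion :: "'o rel \<Rightarrow> 'g inv_seq \<Rightarrow> nat \<Rightarrow> ('o \<Rightarrow> 'g set) monoid" where
  "completion r S i =
     (product_group (Field r) (\<lambda>b. quot_seq r S b i))
       \<lparr>carrier := {x \<in> carrier (product_group (Field r) (\<lambda>b. quot_seq r S b i)).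
          \<forall>b c. (b, c) \<in> r \<longrightarrow> iter_image r S b i <#>\<^bsub>grp S i\<^esub> x c = x b}\<rparr>"

definition completion_map :: "'o rel \<Rightarrow> 'g inv_seq \<Rightarrow> nat \<Rightarrow> 'g \<Rightarrow> ('o \<Rightarrow> 'g set)" where
  "completion_map r S i s = (\<lambda>b\<in>Field r. iter_image r S b i #>\<^bsub>grp S i\<^esub> s)"

definition complete_seq :: "'o rel \<Rightarrow> 'g inv_seq \<Rightarrow> bool" where
  "complete_seq r S \<longleftrightarrow> (\<forall>i. completion_map r S i \<in> epi (grp S i) (completion r S i))"

definition power_seq :: "nat \<Rightarrow> 'g monoid \<Rightarrow> 'g inv_seq" where
  "power_seq p A = \<lparr>grp = (\<lambda>i. A), bond = (\<lambda>i a. a [^]\<^bsub>A\<^esub> p)\<rparr>"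


section \<open>Constructions of abelian groups\<close>

definition iter_power :: "'o rel \<Rightarrow> nat \<Rightarrow> 'g monoid \<Rightarrow> 'o \<Rightarrow> 'g set" where
  "iter_power r p A = trans_iter r (\<lambda>B. (\<lambda>a. a [^]\<^bsub>A\<^esub> p) ` B) (carrier A)"

definition supported_product :: "'k rel \<Rightarrow> 'x set \<Rightarrow> ('x \<Rightarrow> 'g monoid) \<Rightarrow> ('x \<Rightarrow> 'g) monoid" where
  "supported_product k I A =
     (product_group I A)
       \<lparr>carrier := {f \<in> carrier (product_group I A). |{x \<in> I. f x \<noteq> \<one>\<^bsub>A x\<^esub>}| <o k}\<rparr>"

text \<open>
  A \<open>p\<close>-adic integer is the compatible sequence of its residues modulo \<open>p ^ n\<close>, represented in
  \<open>{0..<p ^ n}\<close>.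
\<close>

definition padic_int :: "nat \<Rightarrow> (nat \<Rightarrow> int) ring" where
  "padic_int p =
     \<lparr>carrier = {x. \<forall>n. x n \<in> {0..<int p ^ n} \<and> x (Suc n) mod int p ^ n = x n},
      monoid.mult = (\<lambda>x y n. x n * y n mod int p ^ n),
      one = (\<lambda>n. 1 mod int p ^ n),
      ring.zero = (\<lambda>n. 0),
      add = (\<lambda>x y n. (x n + y n) mod int p ^ n)\<rparr>"

definition power_module :: "('a, 'm) ring_scheme \<Rightarrow> 'x set \<Rightarrow> ('a, 'x \<Rightarrow> 'a) module" where
  "power_module R I =
     \<lparr>carrier = I \<rightarrow>\<^sub>E carrier R,
      monoid.mult = (\<lambda>f g. \<lambda>x\<in>I. f x \<otimes>\<^bsub>R\<^esub> g x),
      one = (\<lambda>x\<in>I. \<one>\<^bsub>R\<^esub>),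
      ring.zero = (\<lambda>x\<in>I. \<zero>\<^bsub>R\<^esub>),
      add = (\<lambda>f g. \<lambda>x\<in>I. f x \<oplus>\<^bsub>R\<^esub> g x),
      smult = (\<lambda>a f. \<lambda>x\<in>I. a \<otimes>\<^bsub>R\<^esub> f x)\<rparr>"

definition basis_vec :: "('a, 'm) ring_scheme \<Rightarrow> 'x set \<Rightarrow> 'x \<Rightarrow> ('x \<Rightarrow> 'a)" where
  "basis_vec R I s = (\<lambda>t\<in>I. if t = s then \<one>\<^bsub>R\<^esub> else \<zero>\<^bsub>R\<^esub>)"

definition submodule_span ::
    "('a, 'm) ring_scheme \<Rightarrow> ('a, 'b, 'n) module_scheme \<Rightarrow> 'b set \<Rightarrow> 'b set" where
  "submodule_span R M G = \<Inter>{N. submodule N R M \<and> G \<subseteq> N}"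


section \<open>The groups \<open>E\<^sub>\<alpha>\<close>\<close>

definition diamond :: "'o rel \<Rightarrow> 'o \<Rightarrow> 'o list set" where
  "diamond r a =
     {s. s \<noteq> [] \<and> sorted_wrt (\<lambda>x y. (x, y) \<in> r \<and> x \<noteq> y) s \<and> set s \<subseteq> underS r a}"

definition P_mod :: "'o rel \<Rightarrow> nat \<Rightarrow> 'o \<Rightarrow> (nat \<Rightarrow> int, 'o list \<Rightarrow> nat \<Rightarrow> int) module" where
  "P_mod r p a = power_module (padic_int p) (diamond r a)"

abbreviation P_basis :: "'o rel \<Rightarrow> nat \<Rightarrow> 'o \<Rightarrow> 'o list \<Rightarrow> ('o list \<Rightarrow> nat \<Rightarrow> int)" where
  "P_basis r p a s \<equiv> basis_vec (padic_int p) (diamond r a) s"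

definition R_gen :: "'o rel \<Rightarrow> nat \<Rightarrow> 'o \<Rightarrow> 'o list \<Rightarrow> ('o list \<Rightarrow> nat \<Rightarrow> int)" where
  "R_gen r p a s =
     (if length s = 1 then add_pow (P_mod r p a) p (P_basis r p a s)
      else add_pow (P_mod r p a) p (P_basis r p a s) \<ominus>\<^bsub>P_mod r p a\<^esub> P_basis r p a (tl s))"

text \<open>
  All generators lie in the direct sum \<open>P'\<^sub>\<alpha>\<close>, a submodule of \<open>P\<^sub>\<alpha>\<close>, so the submodule they
  generate is the same whether it is formed in \<open>P'\<^sub>\<alpha>\<close> or in \<open>P\<^sub>\<alpha>\<close>.
\<close>

definition R_sub :: "'o rel \<Rightarrow> nat \<Rightarrow> 'o \<Rightarrow> ('o list \<Rightarrow> nat \<Rightarrow> int) set" where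
  "R_sub r p a = submodule_span (padic_int p) (P_mod r p a) (R_gen r p a ` diamond r a)"

definition D_grp :: "'o rel \<Rightarrow> nat \<Rightarrow> 'o \<Rightarrow> ('o list \<Rightarrow> nat \<Rightarrow> int) set monoid" where
  "D_grp r p a = P_mod r p a A_Mod R_sub r p a"

definition E_grp :: "'o rel \<Rightarrow> nat \<Rightarrow> 'o \<Rightarrow> ('o list \<Rightarrow> nat \<Rightarrow> int) set set monoid" where
  "E_grp r p a = D_grp r p a Mod iter_power r p (D_grp r p a) a"


section \<open>Well-definedness of the constructions\<close>

lemma subgroup_power_image:
  assumes "comm_group G" "subgroup H G"
  shows "subgroup ((\<lambda>a. a [^]\<^bsub>G\<^esub> (p::nat)) ` H) G"
proof -
  interpret comm_group G by fact
  interpret H: subgroup H G by fact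
  have "group_hom G G (\<lambda>a. a [^]\<^bsub>G\<^esub> p)"
    by unfold_locales (auto simp: hom_def pow_mult_distrib m_comm nat_pow_distrib)
  then show ?thesis
    by (rule group_hom.subgroup_img_is_subgroup) fact
qed

lemma subgroup_iter_power:
  assumes "comm_group G" "Well_order r"
  shows "subgroup (iter_power r p G a) G"
proof -
  interpret comm_group G by fact
  show ?thesis
    unfolding iter_power_def
    by (rule trans_iter_induct[OF assms(2)])
      (auto intro: subgroup_self subgroup_power_image[OF assms(1)] subgroups_Inter)
qed

lemma comm_group_Mod:
  assumes "comm_group G" "subgroup H G"
  shows "comm_group (G Mod H)"
  using assms by (rule comm_group.abelian_FactGroup)

lemma padic_int_cring:
  assumes "p > 0"
  shows "cring (padic_int p)"
proof -
  have pos: "int p ^ n > 0" for n using assms by simp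
  have dv: "int p ^ n dvd int p ^ Suc n" for n by simp
  have red: "(x mod int p ^ Suc n) mod int p ^ n = x mod int p ^ n" for x n
    by (rule mod_mod_cancel) simp
  have closed: "(\<lambda>n. f n mod int p ^ n) \<in> carrier (padic_int p)"
    if "\<And>n. f (Suc n) mod int p ^ n = f n mod int p ^ n" for f
    using that pos red by (auto simp: padic_int_def simp del: power_Suc)
  have C: "x \<in> carrier (padic_int p) \<Longrightarrow> x (Suc n) mod int p ^ n = x n mod int p ^ n"
     and D: "x \<in> carrier (padic_int p) \<Longrightarrow> x n mod int p ^ n = x n" for x n
    by (auto simp: padic_int_def)
  have E1: "x \<in> carrier (padic_int p) \<Longrightarrow> (\<lambda>n. x n mod int p ^ n) = x" for x
    using D by auto
  show ?thesis
  proof (rule cringI)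
    show "abelian_group (padic_int p)"
    proof (rule abelian_groupI)
      fix x y z assume x: "x \<in> carrier (padic_int p)" and y: "y \<in> carrier (padic_int p)"
        and z: "z \<in> carrier (padic_int p)"
      show "x \<oplus>\<^bsub>padic_int p\<^esub> y \<in> carrier (padic_int p)"
        using closed[of "\<lambda>n. x n + y n", OF mod_add_cong[OF C[OF x] C[OF y]]]
        by (simp add: padic_int_def)
      show "x \<oplus>\<^bsub>padic_int p\<^esub> y \<oplus>\<^bsub>padic_int p\<^esub> z = x \<oplus>\<^bsub>padic_int p\<^esub> (y \<oplus>\<^bsub>padic_int p\<^esub> z)"
        by (auto simp: padic_int_def mod_simps add.assoc)
      show "x \<oplus>\<^bsub>padic_int p\<^esub> y = y \<oplus>\<^bsub>padic_int p\<^esub> x"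
        by (auto simp: padic_int_def add.commute)
      show "\<zero>\<^bsub>padic_int p\<^esub> \<oplus>\<^bsub>padic_int p\<^esub> x = x" using E1[OF x] by (auto simp: padic_int_def)
      let ?m = "\<lambda>n. (- x n) mod int p ^ n"
      have "?m \<in> carrier (padic_int p)"
        using closed[of "\<lambda>n. - x n"] C[OF x] by (metis mod_minus_cong)
      moreover have "?m \<oplus>\<^bsub>padic_int p\<^esub> x = \<zero>\<^bsub>padic_int p\<^esub>"
        by (auto simp: padic_int_def mod_simps)
      ultimately show "\<exists>y\<in>carrier (padic_int p). y \<oplus>\<^bsub>padic_int p\<^esub> x = \<zero>\<^bsub>padic_int p\<^esub>" by blast
    next
      show "\<zero>\<^bsub>padic_int p\<^esub> \<in> carrier (padic_int p)" using pos by (auto simp: padic_int_def)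
    qed
    show "comm_monoid (padic_int p)"
    proof (rule comm_monoidI)
      fix x y z assume x: "x \<in> carrier (padic_int p)" and y: "y \<in> carrier (padic_int p)"
        and z: "z \<in> carrier (padic_int p)"
      show "x \<otimes>\<^bsub>padic_int p\<^esub> y \<in> carrier (padic_int p)"
        using closed[of "\<lambda>n. x n * y n", OF mod_mult_cong[OF C[OF x] C[OF y]]]
        by (simp add: padic_int_def)
      show "x \<otimes>\<^bsub>padic_int p\<^esub> y \<otimes>\<^bsub>padic_int p\<^esub> z = x \<otimes>\<^bsub>padic_int p\<^esub> (y \<otimes>\<^bsub>padic_int p\<^esub> z)"
        by (auto simp: padic_int_def mod_simps mult.assoc)
      show "x \<otimes>\<^bsub>padic_int p\<^esub> y = y \<otimes>\<^bsub>padic_int p\<^esub> x"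
        by (auto simp: padic_int_def mult.commute)
      show "\<one>\<^bsub>padic_int p\<^esub> \<otimes>\<^bsub>padic_int p\<^esub> x = x" using E1[OF x] by (auto simp: padic_int_def mod_simps)
    next
      show "\<one>\<^bsub>padic_int p\<^esub> \<in> carrier (padic_int p)"
        using closed[of "\<lambda>n. 1"] by (auto simp: padic_int_def)
    qed
    show "(x \<oplus>\<^bsub>padic_int p\<^esub> y) \<otimes>\<^bsub>padic_int p\<^esub> z =
       x \<otimes>\<^bsub>padic_int p\<^esub> z \<oplus>\<^bsub>padic_int p\<^esub> y \<otimes>\<^bsub>padic_int p\<^esub> z" for x y z
      by (auto simp: padic_int_def mod_simps algebra_simps)
  qed
qed

lemma power_module_module:
  assumes "cring R"
  shows "module R (power_module R I)"
proof -
  interpret cring R by fact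
  have ag: "abelian_group (power_module R I)"
  proof (rule abelian_groupI)
    fix x assume x: "x \<in> carrier (power_module R I)"
    show "\<exists>y\<in>carrier (power_module R I). y \<oplus>\<^bsub>power_module R I\<^esub> x = \<zero>\<^bsub>power_module R I\<^esub>"
      using x by (intro bexI[of _ "\<lambda>i\<in>I. \<ominus>\<^bsub>R\<^esub> x i"])
        (auto simp: power_module_def PiE_def Pi_def extensional_def l_neg)
  qed (auto simp: power_module_def PiE_def Pi_def extensional_def fun_eq_iff a_assoc a_comm a_lcomm)
  show ?thesis
    by (rule moduleI[OF assms ag])
      (auto simp: power_module_def PiE_def Pi_def extensional_def fun_eq_iff l_distr r_distr m_assoc)
qed

lemma R_sub_submodule:
  assumes "p > 0"
  shows "submodule (R_sub r p a) (padic_int p) (P_mod r p a)"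
proof -
  interpret module "padic_int p" "P_mod r p a"
    unfolding P_mod_def by (intro power_module_module padic_int_cring assms)
  have b: "P_basis r p a s \<in> carrier (P_mod r p a)" for s
    by (auto simp: basis_vec_def P_mod_def power_module_def)
  have "R_gen r p a ` diamond r a \<subseteq> carrier (P_mod r p a)"
    using b by (auto simp: R_gen_def)
  then have ne: "{N. submodule N (padic_int p) (P_mod r p a) \<and> R_gen r p a ` diamond r a \<subseteq> N} \<noteq> {}"
    using carrier_is_submodule by blast
  show ?thesis
    unfolding R_sub_def submodule_span_def submodule_def submodule_axioms_def
    using ne
    by (auto intro!: group.subgroups_Inter[OF a_group] simp: submodule_def submodule_axioms_def)
qed

lemma D_grp_comm_group:
  assumes "p > 0"
  shows "comm_group (D_grp r p a)"
proof -
  interpret module "padic_int p" "P_mod r p a"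
    unfolding P_mod_def by (intro power_module_module padic_int_cring assms)
  show ?thesis
    unfolding D_grp_def A_FactGroup_def
    by (rule comm_group_Mod[OF a_comm_group])
      (rule submodule.axioms(1)[OF R_sub_submodule[OF assms]])
qed

lemma E_grp_comm_group:
  assumes "p > 0" "Well_order r"
  shows "comm_group (E_grp r p a)"
  unfolding E_grp_def
  by (intro comm_group_Mod subgroup_iter_power D_grp_comm_group assms)

lemma supported_product_comm_group:
  fixes A :: "'a \<Rightarrow> 'g monoid"
  assumes k: "Cinfinite k" and A: "\<And>x. x \<in> I \<Longrightarrow> comm_group (A x)"
  shows "comm_group (supported_product k I A)"
proof -
  let ?P = "product_group I A"
  interpret P: group ?P by (rule product_group) (simp add: A comm_group.axioms)
  let ?H = "{f \<in> carrier ?P. |{x \<in> I. f x \<noteq> \<one>\<^bsub>A x\<^esub>}| <o k}"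
  have "subgroup ?H ?P"
  proof (rule P.subgroupI)
    have "|{} :: 'a set| <o k" using k
      by (intro finite_ordLess_infinite)
        (auto simp: cinfinite_def Field_card_of intro: card_of_Well_order card_order_on_well_order_on)
    then have "\<one>\<^bsub>?P\<^esub> \<in> ?H" by (auto simp: group.is_monoid A comm_group.axioms)
    then show "?H \<noteq> {}" by blast
  next
    fix f assume f: "f \<in> ?H"
    have fP: "f \<in> carrier ?P" using f by blast
    have "(inv\<^bsub>?P\<^esub> f) x = inv\<^bsub>A x\<^esub> (f x)" if "x \<in> I" for x
      using inv_product_group[of f I A] fP A that by (simp add: comm_group.axioms)
    then have "{x \<in> I. (inv\<^bsub>?P\<^esub> f) x \<noteq> \<one>\<^bsub>A x\<^esub>} \<subseteq> {x \<in> I. f x \<noteq> \<one>\<^bsub>A x\<^esub>}"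
      using A by (auto simp: comm_group.axioms group.is_monoid monoid.inv_one)
    from ordLeq_ordLess_trans[OF card_of_mono1[OF this]]
    show "inv\<^bsub>?P\<^esub> f \<in> ?H"
      using f P.inv_closed[OF fP] by blast
  next
    fix f g assume f: "f \<in> ?H" and g: "g \<in> ?H"
    have "{x \<in> I. (f \<otimes>\<^bsub>?P\<^esub> g) x \<noteq> \<one>\<^bsub>A x\<^esub>}
        \<subseteq> {x \<in> I. f x \<noteq> \<one>\<^bsub>A x\<^esub>} \<union> {x \<in> I. g x \<noteq> \<one>\<^bsub>A x\<^esub>}"
      using A by (auto simp: comm_group.axioms group.is_monoid monoid.l_one)
    moreover have "|{x \<in> I. f x \<noteq> \<one>\<^bsub>A x\<^esub>} \<union> {x \<in> I. g x \<noteq> \<one>\<^bsub>A x\<^esub>}| <o k"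
      using f g k by (intro card_of_Un_ordLess_infinite_Field) (auto simp: cinfinite_def)
    ultimately have "|{x \<in> I. (f \<otimes>\<^bsub>?P\<^esub> g) x \<noteq> \<one>\<^bsub>A x\<^esub>}| <o k"
      by (rule ordLeq_ordLess_trans[OF card_of_mono1])
    then show "f \<otimes>\<^bsub>?P\<^esub> g \<in> ?H"
      using f g P.m_closed by blast
  qed auto
  then have "group (supported_product k I A)"
    unfolding supported_product_def by (rule P.subgroup_imp_group)
  then show ?thesis
    by (rule group.group_comm_groupI)
      (auto simp: supported_product_def PiE_def Pi_def comm_groupE(4)[OF A] cong: restrict_cong)
qed

lemma inverse_sequence_power_seq:
  assumes "comm_group A"
  shows "inverse_sequence (power_seq p A)"
proof -
  interpret comm_group A by fact
  show ?thesis using assms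
    by (auto simp: inverse_sequence_def power_seq_def hom_def nat_pow_distrib)
qed

lemma subgroup_iter_image:
  assumes S: "inverse_sequence S" and r: "Well_order r"
  shows "subgroup (iter_image r S b i) (grp S i)"
proof -
  have G: "group (grp S i)" for i
    using S by (simp add: inverse_sequence_def comm_group.axioms)
  have "\<forall>i. subgroup (iter_image r S b i) (grp S i)"
    unfolding iter_image_def
  proof (rule trans_iter_induct[OF r, where P = "\<lambda>T. \<forall>i. subgroup (T i) (grp S i)"])
    show "\<forall>i. subgroup (carrier (grp S i)) (grp S i)"
      using G group.subgroup_self by blast
  next
    fix T assume T: "\<forall>i. subgroup (T i) (grp S i)"
    have "group_hom (grp S (Suc i)) (grp S i) (bond S i)" for i
      using S G by (simp add: inverse_sequence_def group_hom_def group_hom_axioms_def)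
    then show "\<forall>i. subgroup (image_seq S T i) (grp S i)"
      using T by (auto simp: image_seq_def intro: group_hom.subgroup_img_is_subgroup)
  next
    fix B assume "B \<noteq> {}" "\<And>T. T \<in> B \<Longrightarrow> \<forall>i. subgroup (T i) (grp S i)"
    then show "\<forall>i. subgroup (Inf B i) (grp S i)"
      by (auto simp: Inf_fun_def intro!: group.subgroups_Inter[OF G])
  qed
  then show ?thesis by blast
qed

lemma aleph1_supported_product_E_comm_group:
  assumes "p > 0"
  shows "comm_group (supported_product aleph1 (Field aleph1) (\<lambda>a. E_grp aleph1 p (ord_suc aleph1 a)))"
proof -
  have "Card_order aleph1"
    by (intro cardSuc_Card_order natLeq_Card_order)
  then have wo: "Well_order aleph1"
    by (rule card_order_on_well_order_on)
  show ?thesis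
    by (rule supported_product_comm_group[OF Cinfinite_cardSuc[OF natLeq_Cinfinite]])
      (rule E_grp_comm_group[OF assms wo])
qed

end

theory Submission
  imports Defs "HOL-Library.Countable_Set" Complex_Main
begin

text \<open>
  \<open>S(A)\<close> is local iff every system \<open>a\<^sub>i = c\<^sub>i + p a\<^sub>i\<^sub>+\<^sub>1\<close> has exactly one solution in \<open>A\<close>.  Solutions exist
  in \<open>\<int>\<^sub>p\<close>, hence in products of copies of it, in their quotients and in countably supported
  products; they are unique if \<open>p\<^sup>\<beta>A = 0\<close> for some \<open>\<beta>\<close>.  If all \<open>c\<^sub>i\<close> lie in \<open>p\<^sup>\<gamma>A\<close>, then so do all
  \<open>a\<^sub>i\<close>; choosing \<open>p\<^sup>n c\<^sub>n\<close> to be the differences of representatives along a cofinal sequence, one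
  gets completeness for countable \<open>\<lambda>\<close>.  For \<open>\<lambda> > \<aleph>\<^sub>1\<close> completeness is trivial since \<open>p\<^sup>\<beta>A = 0\<close> for
  \<open>\<beta> = \<aleph>\<^sub>1\<close>.  For \<open>\<lambda> = \<aleph>\<^sub>1\<close> choose \<open>0 \<noteq> x\<^sub>\<alpha> \<in> p\<^sup>\<alpha>E\<^sub>\<alpha>\<^sub>+\<^sub>1\<close>: the truncations of \<open>(x\<^sub>\<alpha>)\<^sub>\<alpha>\<close> to \<open>\<alpha> < \<beta>\<close> form a
  compatible family whose limit would have uncountable support.  The image of \<open>e\<^sub>\<alpha>\<close> serves as
  \<open>x\<^sub>\<alpha>\<close>; that it is not in \<open>p\<^sup>\<alpha>\<^sup>+\<^sup>1D\<^sub>\<alpha>\<^sub>+\<^sub>1\<close> is detected by functionals \<open>P'\<^sub>\<alpha>\<^sub>+\<^sub>1/R\<^sub>\<alpha>\<^sub>+\<^sub>1 \<rightarrow> \<int>[1/p]/\<int>\<close>.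
\<close>

section \<open>Transfinite iteration of a deflationary map\<close>

context
  fixes r :: "'o rel"
  assumes wo: "Well_order r"
begin

lemma underS_mono:
  assumes "(a, b) \<in> r"
  shows "underS r a \<subseteq> underS r b"
proof -
  interpret wo_rel r by (rule wo_rel.intro) (rule wo)
  show ?thesis using underS_incr[OF TRANS ANTISYM assms] .
qed

lemma not_le_imp_underS:
  "a \<in> Field r \<Longrightarrow> b \<in> Field r \<Longrightarrow> (a, b) \<notin> r \<Longrightarrow> b \<in> underS r a"
  using wo_rel.TOTALS[OF wo_rel.intro, OF wo] wo_rel.REFL[OF wo_rel.intro, OF wo]
  by (auto simp: underS_def refl_on_def)

lemma underS_imp_not_le: "b \<in> underS r a \<Longrightarrow> (a, b) \<notin> r"
  using wo_rel.ANTISYM[OF wo_rel.intro, OF wo]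
  by (auto simp: underS_def antisym_def)

lemma is_suc_of_ord_suc:
  assumes "b \<in> underS r a"
  shows "is_suc_of r (ord_suc r b) b"
proof -
  interpret wo_rel r by (rule wo_rel.intro) (rule wo)
  from assms have "b \<in> Field r" "AboveS {b} \<noteq> {}"
    by (auto simp: AboveS_def underS_def Field_def)
  then show ?thesis
    using suc_greater[of "{b}" b] by (auto simp: is_suc_of_def underS_def)
qed

lemma ord_suc_le:
  assumes "b \<in> underS r a"
  shows "(ord_suc r b, a) \<in> r"
proof -
  interpret wo_rel r by (rule wo_rel.intro) (rule wo)
  from assms have "a \<in> AboveS {b}" by (auto simp: AboveS_def underS_def Field_def)
  then show ?thesis by (rule suc_least_AboveS)
qed

lemma underS_is_suc_of:
  assumes "is_suc_of r a c" "b \<in> underS r a"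
  shows "(b, c) \<in> r"
proof (rule ccontr)
  assume n: "(b, c) \<notin> r"
  have F: "b \<in> Field r" "c \<in> Field r"
    using assms by (auto simp: is_suc_of_def underS_def Field_def)
  from not_le_imp_underS[OF F n] have "(a, b) \<in> r"
    using ord_suc_le[of c b] assms(1) by (simp add: is_suc_of_def)
  with underS_imp_not_le[OF assms(2)] show False by blast
qed

lemma trans_iter_is_suc_of:
  assumes "is_suc_of r a c"
  shows "trans_iter r F T a = F (trans_iter r F T c)"
proof -
  have "(THE b. is_suc_of r a b) = c"
    using assms is_suc_of_unique[OF wo] by blast
  moreover have "underS r a \<noteq> {}" using assms by (auto simp: is_suc_of_def)
  ultimately show ?thesis
    using assms by (subst trans_iter_unfold[OF wo]) auto
qed

text \<open>This avoids the case distinction between zero, successors and limits in later inductions.\<close>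

lemma trans_iter_eq_INF:
  fixes F :: "'x::complete_lattice \<Rightarrow> 'x"
  assumes mono: "mono F" and T: "F T \<le> T"
  shows "trans_iter r F T a = inf T (INF b\<in>underS r a. F (trans_iter r F T b))"
proof -
  interpret wo_rel r by (rule wo_rel.intro) (rule wo)
  let ?t = "trans_iter r F T"
  \<comment> \<open>Every stage is shrunk by \<open>F\<close> and lies below \<open>T\<close>;
    monotonicity carries both properties through infima.\<close>
  have P: "F (?t a) \<le> ?t a \<and> ?t a \<le> T" for a
  proof (rule trans_iter_induct[OF wo, where P = "\<lambda>x. F x \<le> x \<and> x \<le> T"])
    show "F T \<le> T \<and> T \<le> T" using T by simp
    show "F (F x) \<le> F x \<and> F x \<le> T" if "F x \<le> x \<and> x \<le> T" for x
      using that monoD[OF mono] T by (meson order_trans)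
    show "F (Inf B) \<le> Inf B \<and> Inf B \<le> T"
      if "B \<noteq> {}" "\<And>x. x \<in> B \<Longrightarrow> F x \<le> x \<and> x \<le> T" for B
      using that monoD[OF mono] by (meson Inf_greatest Inf_lower Inf_less_eq order_trans)
  qed
  have le: "\<forall>b\<in>underS a. ?t a \<le> F (?t b)" for a
  proof (induction a rule: well_order_induct)
    case (1 a)
    show ?case
    proof
      fix b assume b: "b \<in> underS a"
      show "?t a \<le> F (?t b)"
      proof (cases "\<exists>c. is_suc_of r a c")
        case True
        then obtain c where c: "is_suc_of r a c" by blast
        then have ta: "?t a = F (?t c)" by (rule trans_iter_is_suc_of)
        show ?thesis
        proof (cases "b = c")
          case False
          then have "b \<in> underS c" using underS_is_suc_of[OF c b] by (auto simp: underS_def)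
          moreover have "c \<noteq> a" "(c, a) \<in> r" using c by (auto simp: is_suc_of_def underS_def)
          ultimately have "?t c \<le> F (?t b)" using 1 by blast
          then show ?thesis using ta P[of b] monoD[OF mono, of "?t c" "?t b"] by auto
        qed (simp add: ta)
      next
        case False
        \<comment> \<open>Since \<open>a\<close> has no immediate predecessor, the successor of
          \<open>b\<close> is still below \<open>a\<close>. Hence \<open>F (?t b)\<close> is one of
          the terms of the infimum that defines \<open>?t a\<close>.\<close>
        have s: "is_suc_of r (ord_suc r b) b" using b by (rule is_suc_of_ord_suc)
        then have "ord_suc r b \<in> underS a"
          using ord_suc_le[OF b] False by (auto simp: underS_def)
        then have "?t a \<le> ?t (ord_suc r b)"
          using trans_iter_limit[OF wo _ False, of F T] b by (metis INF_lower empty_iff)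
        then show ?thesis unfolding trans_iter_is_suc_of[OF s, of F T] .
      qed
    qed
  qed
  show ?thesis
  proof (rule antisym)
    show "?t a \<le> inf T (INF b\<in>underS a. F (?t b))"
      using le P by (auto intro: INF_greatest)
    consider "underS a = {}" | c where "is_suc_of r a c"
      | "underS a \<noteq> {}" "\<nexists>c. is_suc_of r a c" by blast
    then show "inf T (INF b\<in>underS a. F (?t b)) \<le> ?t a"
    proof cases
      case 1
      then show ?thesis by (simp add: trans_iter_zero[OF wo])
    next
      case (2 c)
      then have "c \<in> underS a" unfolding is_suc_of_def by blast
      then have "(INF b\<in>underS a. F (?t b)) \<le> F (?t c)" by (rule INF_lower)
      then show ?thesis
        unfolding trans_iter_is_suc_of[OF 2, of F T] by (rule le_infI2)
    next
      case 3
      have "(INF b\<in>underS a. F (?t b)) \<le> (INF b\<in>underS a. ?t b)"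
        using P by (intro INF_mono) blast
      then show ?thesis unfolding trans_iter_limit[OF wo 3] by (rule le_infI2)
    qed
  qed
qed

end

lemma limit_ordinal_exists_greater:
  assumes "limit_ordinal l" "a \<in> Field l"
  obtains b where "b \<in> Field l" "a \<in> underS l b"
  using assms by (auto simp: limit_ordinal_def underS_def)

lemma Well_order_aleph1: "Well_order aleph1"
  by (rule cardSuc_Well_order) (rule natLeq_Card_order)

lemma limit_ordinal_aleph1: "limit_ordinal aleph1"
proof -
  have "infinite (Field aleph1)"
    by (simp add: cardSuc_finite[OF natLeq_Card_order] Field_natLeq)
  from infinite_Card_order_limit[OF cardSuc_Card_order[OF natLeq_Card_order] this]
  show ?thesis
    unfolding limit_ordinal_def
    using Well_order_aleph1 Field_cardSuc_not_empty[OF natLeq_Card_order] by blast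
qed

section \<open>The subgroups \<open>p\<^sup>\<beta>G\<close>\<close>

text \<open>The later inductions on ordinals run through this criterion. The roots demanded for
  different \<open>b\<close> need not be related to each other.\<close>

lemma iter_power_iff:
  assumes "comm_group G" "Well_order r"
  shows "x \<in> iter_power r p G a \<longleftrightarrow>
    x \<in> carrier G \<and> (\<forall>b\<in>underS r a. \<exists>y\<in>iter_power r p G b. x = y [^]\<^bsub>G\<^esub> p)"
proof -
  interpret comm_group G by fact
  have "mono (\<lambda>B. (\<lambda>a. a [^]\<^bsub>G\<^esub> p) ` B)" by (auto intro: monoI)
  moreover have "(\<lambda>a. a [^]\<^bsub>G\<^esub> p) ` carrier G \<subseteq> carrier G" by auto
  ultimately have "iter_power r p G a =
      carrier G \<inter> (\<Inter>b\<in>underS r a. (\<lambda>a. a [^]\<^bsub>G\<^esub> p) ` iter_power r p G b)"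
    unfolding iter_power_def by (intro trans_iter_eq_INF assms)
  then show ?thesis by blast
qed

lemma iter_power_carrier:
  "comm_group G \<Longrightarrow> Well_order r \<Longrightarrow> iter_power r p G a \<subseteq> carrier G"
  by (auto simp: iter_power_iff[of G r _ p a])

lemma iter_power_antimono:
  assumes "comm_group G" "Well_order r" "(a, b) \<in> r"
  shows "iter_power r p G b \<subseteq> iter_power r p G a"
  using underS_mono[OF assms(2,3)]
    iter_power_iff[OF assms(1,2), of _ p a] iter_power_iff[OF assms(1,2), of _ p b] by blast

lemma iter_power_is_suc_of:
  assumes "Well_order r" "is_suc_of r a b"
  shows "iter_power r p G a = (\<lambda>x. x [^]\<^bsub>G\<^esub> p) ` iter_power r p G b"
  unfolding iter_power_def by (rule trans_iter_is_suc_of[OF assms])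

text \<open>A strictly increasing map cannot lower the position of an ordinal. By induction, a root
  that exists at stage \<open>f b\<close> also serves at stage \<open>b\<close>. This compares
  powers indexed by well-orders on different types.\<close>

lemma iter_power_strict_mono_subset:
  assumes "comm_group G" "Well_order r" "Well_order s"
    and f: "\<And>a b. b \<in> underS r a \<Longrightarrow> f b \<in> underS s (f a)"
  shows "iter_power s p G (f a) \<subseteq> iter_power r p G a"
proof -
  interpret wo_rel r by (rule wo_rel.intro) fact
  show ?thesis
  proof (induction a rule: well_order_induct)
    case (1 a)
    show ?case
    proof
      fix x assume x: "x \<in> iter_power s p G (f a)"
      have "\<exists>y\<in>iter_power r p G b. x = y [^]\<^bsub>G\<^esub> p" if b: "b \<in> underS a" for b
      proof -
        obtain y where "y \<in> iter_power s p G (f b)" "x = y [^]\<^bsub>G\<^esub> p"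
          using x f[OF b] iter_power_iff[OF assms(1,3), of x p "f a"] by blast
        moreover have "iter_power s p G (f b) \<subseteq> iter_power r p G b"
          using 1 b by (auto simp: underS_def)
        ultimately show ?thesis by blast
      qed
      then show "x \<in> iter_power r p G a"
        using iter_power_iff[OF assms(1,2), of x p a] iter_power_carrier[OF assms(1,3)] x by blast
    qed
  qed
qed

text \<open>All groups and all bonds of S(G) coincide, so every stage of the iteration is a constant
  family. Completeness of S(G) thereby becomes a statement about the subgroups
  \<open>p^b G\<close>.\<close>

lemma iter_image_power_seq:
  assumes wo: "Well_order r"
  shows "iter_image r (power_seq p G) b i = iter_power r p G b"
proof -
  interpret wo_rel r by (rule wo_rel.intro) fact
  let ?F = "image_seq (power_seq p G)" and ?T = "\<lambda>i. carrier (grp (power_seq p G) i)"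
  have "trans_iter r ?F ?T b = (\<lambda>i. iter_power r p G b)"
  proof (induction b rule: well_order_induct)
    case (1 b)
    consider "underS b = {}" | c where "is_suc_of r b c"
      | "underS b \<noteq> {}" "\<nexists>c. is_suc_of r b c" by blast
    then show ?case
    proof cases
      case 1
      then show ?thesis by (simp add: trans_iter_zero[OF wo] iter_power_def power_seq_def)
    next
      case (2 c)
      then have "c \<noteq> b" "(c, b) \<in> r" by (auto simp: is_suc_of_def underS_def)
      with 1 show ?thesis
        by (simp add: trans_iter_is_suc_of[OF wo 2] iter_power_is_suc_of[OF wo 2]
            image_seq_def power_seq_def)
    next
      case 3
      have "trans_iter r ?F ?T b = (INF c\<in>underS b. trans_iter r ?F ?T c)"
        by (rule trans_iter_limit[OF wo 3])
      also have "\<dots> = (INF c\<in>underS b. (\<lambda>i. iter_power r p G c))"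
        using 1 by (intro INF_cong) (auto simp: underS_def)
      also have "\<dots> = (\<lambda>i. iter_power r p G b)"
        unfolding iter_power_def trans_iter_limit[OF wo 3] by (auto simp: fun_eq_iff)
      finally show ?thesis .
    qed
  qed
  then show ?thesis by (simp add: iter_image_def)
qed

section \<open>Locality and completeness of \<open>S(A)\<close>\<close>

text \<open>Surjectivity of 1 - F on S(G), hence the vanishing of lim^1. As a system of equations it
  can be checked coordinatewise and passed to quotients.\<close>

definition telescopic :: "nat \<Rightarrow> ('g, 'm) monoid_scheme \<Rightarrow> bool" where
  "telescopic p G \<longleftrightarrow> (\<forall>c\<in>UNIV \<rightarrow> carrier G. \<exists>a\<in>UNIV \<rightarrow> carrier G.
     \<forall>i. a i = c i \<otimes>\<^bsub>G\<^esub> a (Suc i) [^]\<^bsub>G\<^esub> p)"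

text \<open>Injectivity of 1 - F on S(G), hence the vanishing of lim.\<close>

definition power_reduced :: "nat \<Rightarrow> 'g monoid \<Rightarrow> bool" where
  "power_reduced p G \<longleftrightarrow> (\<forall>a\<in>UNIV \<rightarrow> carrier G.
     (\<forall>i. a i = a (Suc i) [^]\<^bsub>G\<^esub> p) \<longrightarrow> (\<forall>i. a i = \<one>\<^bsub>G\<^esub>))"

text \<open>Induction on \<open>c\<close> for all terms of the sequence at once: the root of
  \<open>a i\<close> that is required in \<open>p^d G\<close> is \<open>a (Suc i)\<close>. So the
  whole sequence lies in every \<open>p^c G\<close>.\<close>

lemma power_reducedI:
  assumes G: "comm_group G" and wo: "Well_order r" and triv: "iter_power r p G b = {\<one>\<^bsub>G\<^esub>}"
  shows "power_reduced p G"
proof -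
  interpret wo_rel r by (rule wo_rel.intro) fact
  have "a i \<in> iter_power r p G c"
    if a: "a \<in> UNIV \<rightarrow> carrier G" "\<forall>i. a i = a (Suc i) [^]\<^bsub>G\<^esub> p" for a i c
  proof (induction c arbitrary: i rule: well_order_induct)
    case (1 c)
    have "\<exists>y\<in>iter_power r p G d. a i = y [^]\<^bsub>G\<^esub> p" if d: "d \<in> underS c" for d
    proof
      show "a (Suc i) \<in> iter_power r p G d" using 1 d by (simp add: underS_def)
    qed (use a(2) in blast)
    then show ?case
      using iter_power_iff[OF G wo, of "a i" p c] a by blast
  qed
  then show ?thesis
    unfolding power_reduced_def using triv by blast
qed

text \<open>The difference of two solutions solves the homogeneous system.\<close>

lemma power_reduced_unique:
  assumes G: "comm_group G" and red: "power_reduced p G"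
    and a: "a \<in> UNIV \<rightarrow> carrier G" "\<And>i. a i = c i \<otimes>\<^bsub>G\<^esub> a (Suc i) [^]\<^bsub>G\<^esub> p"
    and b: "b \<in> UNIV \<rightarrow> carrier G" "\<And>i. b i = c i \<otimes>\<^bsub>G\<^esub> b (Suc i) [^]\<^bsub>G\<^esub> p"
    and c: "c \<in> UNIV \<rightarrow> carrier G"
  shows "a = b"
proof -
  interpret comm_group G by fact
  have A: "a i \<in> carrier G" and B: "b i \<in> carrier G" and C: "c i \<in> carrier G" for i
    using a(1) b(1) c by auto
  have "a i \<otimes>\<^bsub>G\<^esub> inv\<^bsub>G\<^esub> b i = (a (Suc i) \<otimes>\<^bsub>G\<^esub> inv\<^bsub>G\<^esub> b (Suc i)) [^]\<^bsub>G\<^esub> p" for i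
  proof -
    have "a i \<otimes>\<^bsub>G\<^esub> inv\<^bsub>G\<^esub> b i =
        (c i \<otimes>\<^bsub>G\<^esub> a (Suc i) [^]\<^bsub>G\<^esub> p) \<otimes>\<^bsub>G\<^esub> inv\<^bsub>G\<^esub> (c i \<otimes>\<^bsub>G\<^esub> b (Suc i) [^]\<^bsub>G\<^esub> p)"
      by (subst a(2), subst b(2)) simp
    also have "\<dots> = a (Suc i) [^]\<^bsub>G\<^esub> p \<otimes>\<^bsub>G\<^esub> inv\<^bsub>G\<^esub> (b (Suc i) [^]\<^bsub>G\<^esub> p)"
    proof -
      have "c i \<otimes>\<^bsub>G\<^esub> u \<otimes>\<^bsub>G\<^esub> inv\<^bsub>G\<^esub> (c i \<otimes>\<^bsub>G\<^esub> v) = u \<otimes>\<^bsub>G\<^esub> inv\<^bsub>G\<^esub> v"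
        if "u \<in> carrier G" "v \<in> carrier G" for u v
      proof -
        have "c i \<otimes>\<^bsub>G\<^esub> u \<otimes>\<^bsub>G\<^esub> inv\<^bsub>G\<^esub> (c i \<otimes>\<^bsub>G\<^esub> v) =
            (c i \<otimes>\<^bsub>G\<^esub> inv\<^bsub>G\<^esub> c i) \<otimes>\<^bsub>G\<^esub> (u \<otimes>\<^bsub>G\<^esub> inv\<^bsub>G\<^esub> v)"
          using that C[of i] by (simp add: inv_mult m_ac del: r_inv)
        then show ?thesis using that C[of i] by simp
      qed
      then show ?thesis using A B by simp
    qed
    also have "\<dots> = (a (Suc i) \<otimes>\<^bsub>G\<^esub> inv\<^bsub>G\<^esub> b (Suc i)) [^]\<^bsub>G\<^esub> p"
      using A B by (simp add: nat_pow_distrib nat_pow_inv)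
    finally show ?thesis .
  qed
  moreover have "(\<lambda>i. a i \<otimes>\<^bsub>G\<^esub> inv\<^bsub>G\<^esub> b i) \<in> UNIV \<rightarrow> carrier G" using A B by simp
  ultimately have "a i \<otimes>\<^bsub>G\<^esub> inv\<^bsub>G\<^esub> b i = \<one>\<^bsub>G\<^esub>" for i
    using red[unfolded power_reduced_def, rule_format, of "\<lambda>i. a i \<otimes>\<^bsub>G\<^esub> inv\<^bsub>G\<^esub> b i" i] by blast
  then have "a i = b i" for i
    using A B by (metis inv_equality inv_inv inv_closed)
  then show ?thesis by auto
qed

text \<open>For d < g choose roots \<open>c' i\<close> of the constants in \<open>p^d G\<close> and
  solve the system for them. The solution \<open>a'\<close> lies in \<open>p^d G\<close> by
  induction, and p a' solves the original system, so it equals \<open>a\<close> by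
  uniqueness.\<close>

lemma iter_power_solution:
  assumes G: "comm_group G" and wo: "Well_order r"
    and tel: "telescopic p G" and red: "power_reduced p G"
    and "a \<in> UNIV \<rightarrow> carrier G" "\<And>i. a i = c i \<otimes>\<^bsub>G\<^esub> a (Suc i) [^]\<^bsub>G\<^esub> p"
    and "\<And>i. c i \<in> iter_power r p G g"
  shows "a i \<in> iter_power r p G g"
proof -
  interpret comm_group G by fact
  interpret wo_rel r by (rule wo_rel.intro) fact
  show ?thesis using assms(5-7)
  proof (induction g arbitrary: a c i rule: well_order_induct)
    case (1 g)
    have "\<exists>y\<in>iter_power r p G d. a i = y [^]\<^bsub>G\<^esub> p" if d: "d \<in> underS g" for d
    proof -
      have "\<exists>y\<in>iter_power r p G d. c i = y [^]\<^bsub>G\<^esub> p" for i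
        using 1(4) iter_power_iff[OF G wo, of "c i" p g] d by blast
      then obtain c' where c': "\<And>i. c' i \<in> iter_power r p G d" "\<And>i. c i = c' i [^]\<^bsub>G\<^esub> p"
        by metis
      then have cc': "c' i \<in> carrier G" for i using iter_power_carrier[OF G wo] by blast
      then obtain a' where a': "a' \<in> UNIV \<rightarrow> carrier G"
          "\<And>i. a' i = c' i \<otimes>\<^bsub>G\<^esub> a' (Suc i) [^]\<^bsub>G\<^esub> p"
        using tel unfolding telescopic_def by (metis Pi_I)
      have "a = (\<lambda>i. a' i [^]\<^bsub>G\<^esub> p)"
      proof (rule power_reduced_unique[OF G red 1(2,3)])
        show "a' i [^]\<^bsub>G\<^esub> p = c i \<otimes>\<^bsub>G\<^esub> (a' (Suc i) [^]\<^bsub>G\<^esub> p) [^]\<^bsub>G\<^esub> p" for i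
          using cc' a'(1) by (subst a'(2)) (simp add: c'(2) nat_pow_distrib Pi_iff)
      qed (use a'(1) cc' c'(2) in auto)
      moreover have "a' i \<in> iter_power r p G d"
      proof -
        have "(d, g) \<in> r" "d \<noteq> g" using d by (auto simp: underS_def)
        then show ?thesis using 1(1) a' c'(1) by blast
      qed
      ultimately show ?thesis by auto
    qed
    then show ?case
      using iter_power_iff[OF G wo, of "a i" p g] 1(2) by blast
  qed
qed

text \<open>A solution for representatives of the constants projects to a solution in the
  quotient.\<close>

lemma telescopic_Mod:
  assumes G: "comm_group G" and H: "subgroup H G" and tel: "telescopic p G"
  shows "telescopic p (G Mod H)"
  unfolding telescopic_def
proof
  interpret comm_group G by fact
  interpret normal H G using H by (simp add: normal_iff_subgroup)
  fix C :: "nat \<Rightarrow> _" assume "C \<in> UNIV \<rightarrow> carrier (G Mod H)"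
  then have "\<exists>c\<in>carrier G. C i = H #>\<^bsub>G\<^esub> c" for i
    by (auto simp: carrier_FactGroup)
  then obtain c where c: "\<And>i::nat. c i \<in> carrier G" "\<And>i::nat. C i = H #>\<^bsub>G\<^esub> c i" by metis
  then obtain a where a: "\<And>i. a i \<in> carrier G" "\<And>i. a i = c i \<otimes>\<^bsub>G\<^esub> a (Suc i) [^]\<^bsub>G\<^esub> p"
    using tel unfolding telescopic_def by (metis PiE Pi_I UNIV_I)
  have "H #>\<^bsub>G\<^esub> a i = C i \<otimes>\<^bsub>G Mod H\<^esub> (H #>\<^bsub>G\<^esub> a (Suc i)) [^]\<^bsub>G Mod H\<^esub> p" for i
  proof -
    have "H #>\<^bsub>G\<^esub> (c i \<otimes>\<^bsub>G\<^esub> a (Suc i) [^]\<^bsub>G\<^esub> p) = (H #>\<^bsub>G\<^esub> c i) <#>\<^bsub>G\<^esub> (H #>\<^bsub>G\<^esub> a (Suc i) [^]\<^bsub>G\<^esub> p)"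
      using a(1) c(1) by (simp add: rcos_sum)
    then show ?thesis by (simp only: FactGroup_pow[OF a(1)] c(2) mult_FactGroup a(2)[symmetric])
  qed
  then show "\<exists>a\<in>UNIV \<rightarrow> carrier (G Mod H). \<forall>i. a i = C i \<otimes>\<^bsub>G Mod H\<^esub> a (Suc i) [^]\<^bsub>G Mod H\<^esub> p"
  proof (intro bexI allI)
    show "(\<lambda>i. H #>\<^bsub>G\<^esub> a i) \<in> UNIV \<rightarrow> carrier (G Mod H)"
      using a(1) by (auto simp: carrier_FactGroup)
  qed
qed

lemma local_power_seq:
  assumes G: "comm_group G" and tel: "telescopic p G" and red: "power_reduced p G"
  shows "local_seq (power_seq p G)"
proof -
  interpret comm_group G by fact
  let ?S = "power_seq p G"
  let ?P = "seq_prod ?S" and ?f = "one_minus_shift ?S"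
  have grp: "grp ?S = (\<lambda>i. G)" by (simp add: power_seq_def)
  have P: "comm_group ?P"
    unfolding grp
    by (rule group.group_comm_groupI) (auto simp: PiE_def Pi_def m_comm)
  interpret P: comm_group ?P by fact
  have f: "?f x = (\<lambda>i. x i \<otimes>\<^bsub>G\<^esub> inv\<^bsub>G\<^esub> (x (Suc i) [^]\<^bsub>G\<^esub> p))" if "x \<in> carrier ?P" for x
  proof -
    have "shift ?S x \<in> carrier ?P"
      using that by (auto simp: shift_def power_seq_def)
    then show ?thesis
      unfolding one_minus_shift_def grp
      by (subst inv_product_group) (auto simp: shift_def power_seq_def grp)
  qed
  have fhom: "group_hom ?P ?P ?f"
  proof (unfold_locales, rule homI)
    fix x y assume x: "x \<in> carrier ?P" and y: "y \<in> carrier ?P"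
    have X: "x i \<in> carrier G" and Y: "y i \<in> carrier G" for i using x y by (auto simp: grp)
    show "?f x \<in> carrier ?P"
      using X by (subst f[OF x]) (simp add: grp PiE_def)
    have "x i \<otimes>\<^bsub>G\<^esub> y i \<otimes>\<^bsub>G\<^esub> inv\<^bsub>G\<^esub> ((x (Suc i) \<otimes>\<^bsub>G\<^esub> y (Suc i)) [^]\<^bsub>G\<^esub> p) =
       x i \<otimes>\<^bsub>G\<^esub> inv\<^bsub>G\<^esub> (x (Suc i) [^]\<^bsub>G\<^esub> p) \<otimes>\<^bsub>G\<^esub> (y i \<otimes>\<^bsub>G\<^esub> inv\<^bsub>G\<^esub> (y (Suc i) [^]\<^bsub>G\<^esub> p))" for i
      using X Y by (simp add: nat_pow_distrib inv_mult m_ac)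
    then show "?f (x \<otimes>\<^bsub>?P\<^esub> y) = ?f x \<otimes>\<^bsub>?P\<^esub> ?f y"
      unfolding f[OF x] f[OF y] f[OF P.m_closed[OF x y]] by (simp add: grp fun_eq_iff)
  qed
  interpret f: group_hom ?P ?P ?f by (rule fhom)
  have "kernel ?P ?P ?f = {\<one>\<^bsub>?P\<^esub>}"
  proof -
    have "x = \<one>\<^bsub>?P\<^esub>" if x: "x \<in> carrier ?P" "?f x = \<one>\<^bsub>?P\<^esub>" for x
    proof -
      have X: "x i \<in> carrier G" for i using x by (auto simp: grp)
      have "x i \<otimes>\<^bsub>G\<^esub> inv\<^bsub>G\<^esub> (x (Suc i) [^]\<^bsub>G\<^esub> p) = \<one>\<^bsub>G\<^esub>" for i
        using x(2) f[OF x(1)] by (metis (no_types, lifting) UNIV_I grp one_product_group restrict_apply)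
      then have "x i = x (Suc i) [^]\<^bsub>G\<^esub> p" for i
        using X by (metis inv_equality inv_inv inv_closed nat_pow_closed)
      then have "x i = \<one>\<^bsub>G\<^esub>" for i
        using red X unfolding power_reduced_def by (metis Pi_I)
      then show ?thesis by (auto simp: grp)
    qed
    then show ?thesis unfolding kernel_def using f.hom_one P.one_closed by blast
  qed
  then have lim: "trivial_group (inv_lim ?S)"
    unfolding inv_lim_def trivial_group_def
    using P.subgroup_imp_group[OF f.subgroup_kernel] by simp
  have "?f ` carrier ?P = carrier ?P"
  proof
    show "carrier ?P \<subseteq> ?f ` carrier ?P"
    proof
      fix c assume "c \<in> carrier ?P"
      then have c: "c i \<in> carrier G" for i by (auto simp: grp)
      then obtain a where a: "\<And>i. a i \<in> carrier G" "\<And>i. a i = c i \<otimes>\<^bsub>G\<^esub> a (Suc i) [^]\<^bsub>G\<^esub> p"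
        using tel unfolding telescopic_def by (metis PiE Pi_I UNIV_I)
      have aP: "a \<in> carrier ?P" using a(1) by (auto simp: grp)
      have "a i \<otimes>\<^bsub>G\<^esub> inv\<^bsub>G\<^esub> (a (Suc i) [^]\<^bsub>G\<^esub> p) = c i" for i
        using a(1) c by (subst a(2)) (simp add: m_assoc)
      then have "?f a = c" using f[OF aP] by auto
      then show "c \<in> ?f ` carrier ?P" using aP by blast
    qed
  qed (use f.hom_closed in blast)
  moreover have "carrier (?P Mod carrier ?P) = {carrier ?P}"
  proof -
    have "carrier ?P #>\<^bsub>?P\<^esub> x = carrier ?P" if "x \<in> carrier ?P" for x
      by (rule P.coset_join2[OF that P.subgroup_self that])
    then show ?thesis unfolding carrier_FactGroup using P.one_closed by blast
  qed
  ultimately have "trivial_group (inv_lim1 ?S)"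
    unfolding inv_lim1_def trivial_group_def
    using comm_group_Mod[OF P P.subgroup_self] by (simp add: comm_group.axioms)
  with lim show ?thesis by (simp add: local_seq_def)
qed

text \<open>The element \<open>s\<^sub>0 + \<Sum>p\<^sup>n c\<^sub>n\<close> is \<open>s\<^sub>0 + a\<^sub>0\<close> for the solution of \<open>a\<^sub>n = c\<^sub>n + p a\<^sub>n\<^sub>+\<^sub>1\<close>.\<close>

lemma iter_power_limit_of_sequence:
  assumes G: "comm_group G" and wo: "Well_order l"
    and tel: "telescopic p G" and red: "power_reduced p G"
    and g: "\<And>n. (g n, g (Suc n)) \<in> l"
    and c: "\<And>n. c n \<in> iter_power l p G (g n)"
    and s: "\<And>n. s n \<in> carrier G"
      "\<And>n. s (Suc n) = s n \<otimes>\<^bsub>G\<^esub> c n [^]\<^bsub>G\<^esub> (p ^ n)"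
  obtains x where "x \<in> carrier G" "\<And>n. \<exists>y\<in>iter_power l p G (g n). x = y \<otimes>\<^bsub>G\<^esub> s n"
proof -
  interpret comm_group G by fact
  interpret wo_rel l by (rule wo_rel.intro) fact
  have cc: "c n \<in> carrier G" for n using c iter_power_carrier[OF G wo] by blast
  then obtain a where a: "\<And>i. a i \<in> carrier G" "\<And>i. a i = c i \<otimes>\<^bsub>G\<^esub> a (Suc i) [^]\<^bsub>G\<^esub> p"
    using tel unfolding telescopic_def by (metis PiE Pi_I UNIV_I)
  have gg: "(g n, g (n + k)) \<in> l" for n k
  proof (induction k)
    case 0
    have "g n \<in> Field l" using g[of n] by (auto simp: Field_def)
    then show ?case using REFL by (simp add: refl_on_def)
  next
    case (Suc k)
    then show ?case using g[of "n + k"] TRANS by (metis add_Suc_right transD)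
  qed
  \<comment> \<open>The system shifted by \<open>n\<close> has all its constants in
    \<open>p^(g n) G\<close>, because \<open>g\<close> is monotone; its solution starts with
    \<open>a n\<close>.\<close>
  have an: "a n \<in> iter_power l p G (g n)" for n
  proof -
    have "a (n + 0) \<in> iter_power l p G (g n)"
    proof (rule iter_power_solution[OF G wo tel red, where a = "\<lambda>i. a (n + i)" and c = "\<lambda>i. c (n + i)"])
      show "c (n + i) \<in> iter_power l p G (g n)" for i
        using c iter_power_antimono[OF G wo gg] by blast
      show "a (n + i) = c (n + i) \<otimes>\<^bsub>G\<^esub> a (n + Suc i) [^]\<^bsub>G\<^esub> p" for i
        using a(2)[of "n + i"] by simp
    qed (use a(1) in auto)
    then show ?thesis by simp
  qed
  \<comment> \<open>The quantity p^n a_n + s_n does not depend on \<open>n\<close>: unfolding a_n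
    moves p^n c_n into s_(n+1).\<close>
  have xn: "a 0 \<otimes>\<^bsub>G\<^esub> s 0 = a n [^]\<^bsub>G\<^esub> (p ^ n) \<otimes>\<^bsub>G\<^esub> s n" for n
  proof (induction n)
    case (Suc n)
    have "a n [^]\<^bsub>G\<^esub> (p ^ n) = c n [^]\<^bsub>G\<^esub> (p ^ n) \<otimes>\<^bsub>G\<^esub> a (Suc n) [^]\<^bsub>G\<^esub> (p ^ Suc n)"
      using a(1) cc by (subst a(2)) (simp add: nat_pow_distrib nat_pow_pow)
    then show ?case
      using Suc s(1) a(1) cc by (simp add: s(2) m_ac del: power_Suc)
  qed (use a(1) s(1) in simp)
  have "\<exists>y\<in>iter_power l p G (g n). a 0 \<otimes>\<^bsub>G\<^esub> s 0 = y \<otimes>\<^bsub>G\<^esub> s n" for n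
  proof -
    interpret H: subgroup "iter_power l p G (g n)" G by (rule subgroup_iter_power[OF G wo])
    have "x [^]\<^bsub>G\<^esub> (k::nat) \<in> iter_power l p G (g n)" if "x \<in> iter_power l p G (g n)" for k x
      by (induction k) (use that in auto)
    from this[OF an[of n]] show ?thesis by (rule rev_bexI) (rule xn)
  qed
  then show thesis using that[OF m_closed[OF a(1) s(1)]] by blast
qed

section \<open>Completeness of S(G)\<close>

lemma iter_power_mult_coset:
  assumes G: "comm_group G" and wo: "Well_order r" and bc: "(b, c) \<in> r" and t: "t \<in> carrier G"
  shows "iter_power r p G b <#>\<^bsub>G\<^esub> (iter_power r p G c #>\<^bsub>G\<^esub> t) = iter_power r p G b #>\<^bsub>G\<^esub> t"
proof -
  interpret comm_group G by fact
  let ?N = "iter_power r p G"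
  interpret B: subgroup "?N b" G by (rule subgroup_iter_power[OF G wo])
  interpret C: subgroup "?N c" G by (rule subgroup_iter_power[OF G wo])
  have "?N b <#>\<^bsub>G\<^esub> ?N c = ?N b"
  proof
    show "?N b <#>\<^bsub>G\<^esub> ?N c \<subseteq> ?N b"
      using iter_power_antimono[OF G wo bc, of p] by (auto simp: set_mult_def)
    have "x = x \<otimes>\<^bsub>G\<^esub> \<one>\<^bsub>G\<^esub>" if "x \<in> ?N b" for x using that by simp
    then show "?N b \<subseteq> ?N b <#>\<^bsub>G\<^esub> ?N c"
      using C.one_closed unfolding set_mult_def by blast
  qed
  then show ?thesis
    using setmult_rcos_assoc[OF B.subset C.subset t] by simp
qed

text \<open>The index \<open>i\<close> does not matter for S(G), and the natural map is a
  homomorphism into the completion anyway, so only surjectivity remains. The families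
  \<open>x\<close> are constrained on \<open>Field r\<close> alone, which spares later proofs the
  extensionality conditions.\<close>

lemma complete_power_seq_iff:
  fixes G :: "'g monoid" and r :: "'o rel"
  assumes G: "comm_group G" and wo: "Well_order r"
  shows "complete_seq r (power_seq p G) \<longleftrightarrow>
    (\<forall>x. (\<forall>b\<in>Field r. x b \<in> carrier (G Mod iter_power r p G b)) \<longrightarrow>
      (\<forall>b c. (b, c) \<in> r \<longrightarrow> iter_power r p G b <#>\<^bsub>G\<^esub> x c = x b) \<longrightarrow>
      (\<exists>s\<in>carrier G. \<forall>b\<in>Field r. x b = iter_power r p G b #>\<^bsub>G\<^esub> s))"
    (is "_ \<longleftrightarrow> ?surj")
proof -
  interpret comm_group G by fact
  let ?N = "iter_power r p G" and ?S = "power_seq p G"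
  have N: "?N b \<lhd> G" for b by (simp add: normal_iff_subgroup subgroup_iter_power[OF G wo])
  have grp: "grp ?S i = G" for i by (simp add: power_seq_def)
  have map: "completion_map r ?S i s = (\<lambda>b\<in>Field r. ?N b #>\<^bsub>G\<^esub> s)" for i s
    by (simp add: completion_map_def iter_image_power_seq[OF wo] grp)
  have carr: "carrier (completion r ?S i) = {x \<in> (\<Pi>\<^sub>E b\<in>Field r. carrier (G Mod ?N b)).
      \<forall>b c. (b, c) \<in> r \<longrightarrow> ?N b <#>\<^bsub>G\<^esub> x c = x b}" for i
    by (simp add: completion_def quot_seq_def iter_image_power_seq[OF wo] grp)
  have mult: "x \<otimes>\<^bsub>completion r ?S i\<^esub> y = (\<lambda>b\<in>Field r. x b <#>\<^bsub>G\<^esub> y b)" for i x y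
    by (simp add: completion_def quot_seq_def iter_image_power_seq[OF wo] grp)
  have closed: "completion_map r ?S i s \<in> carrier (completion r ?S i)" if "s \<in> carrier G" for i s
    using that iter_power_mult_coset[OF G wo] by (auto simp: map carr carrier_FactGroup Field_def)
  have hom: "completion_map r ?S i \<in> hom (grp ?S i) (completion r ?S i)" for i
    unfolding grp
  proof (rule homI)
    fix x y assume "x \<in> carrier G" "y \<in> carrier G"
    then show "completion_map r ?S i (x \<otimes>\<^bsub>G\<^esub> y) =
       completion_map r ?S i x \<otimes>\<^bsub>completion r ?S i\<^esub> completion_map r ?S i y"
      using normal.rcos_sum[OF N] by (simp add: mult map fun_eq_iff)
  qed (rule closed)
  show ?thesis
  proof
    assume surj: ?surj
    have "x \<in> completion_map r ?S i ` carrier G" if "x \<in> carrier (completion r ?S i)" for i x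
    proof -
      have x: "x \<in> (\<Pi>\<^sub>E b\<in>Field r. carrier (G Mod ?N b))"
          "\<forall>b c. (b, c) \<in> r \<longrightarrow> ?N b <#>\<^bsub>G\<^esub> x c = x b"
        using that by (auto simp: carr)
      obtain s where s: "s \<in> carrier G" "\<forall>b\<in>Field r. x b = ?N b #>\<^bsub>G\<^esub> s"
        using surj x by blast
      have "x = completion_map r ?S i s"
        unfolding map using s(2) x(1) by (auto simp: fun_eq_iff PiE_def extensional_def)
      then show ?thesis using s(1) by blast
    qed
    then show "complete_seq r ?S"
      unfolding complete_seq_def epi_def using hom closed by (auto simp: grp)
  next
    assume comp: "complete_seq r ?S"
    show ?surj
    proof (intro allI impI)
      fix x assume x: "\<forall>b\<in>Field r. x b \<in> carrier (G Mod ?N b)"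
        "\<forall>b c. (b, c) \<in> r \<longrightarrow> ?N b <#>\<^bsub>G\<^esub> x c = x b"
      have "restrict x (Field r) \<in> carrier (completion r ?S 0)"
        using x by (auto simp: carr Field_def)
      also have "\<dots> = completion_map r ?S 0 ` carrier G"
        using comp by (simp add: complete_seq_def epi_def grp)
      finally obtain s where s: "s \<in> carrier G" "restrict x (Field r) = completion_map r ?S 0 s"
        by blast
      have "x b = ?N b #>\<^bsub>G\<^esub> s" if "b \<in> Field r" for b
        using fun_cong[OF s(2), of b] that by (simp add: map)
      then show "\<exists>s\<in>carrier G. \<forall>b\<in>Field r. x b = ?N b #>\<^bsub>G\<^esub> s" using s(1) by blast
    qed
  qed
qed

lemmas complete_power_seqI = complete_power_seq_iff[THEN iffD2, rule_format]

text \<open>From \<open>b\<close> on all cosets are singletons and the projections between them are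
  identities. The only element of \<open>x b\<close> therefore represents the family above
  \<open>b\<close>, and below \<open>b\<close> it does so by projection.\<close>

lemma complete_power_seq_of_trivial:
  assumes G: "comm_group G" and wo: "Well_order l"
    and b: "b \<in> Field l" "iter_power l p G b = {\<one>\<^bsub>G\<^esub>}"
  shows "complete_seq l (power_seq p G)"
proof (rule complete_power_seqI[OF G wo])
  interpret comm_group G by fact
  interpret wo_rel l by (rule wo_rel.intro) fact
  let ?N = "iter_power l p G"
  fix x assume x: "\<And>b. b \<in> Field l \<Longrightarrow> x b \<in> carrier (G Mod ?N b)"
    "\<And>b c. (b, c) \<in> l \<Longrightarrow> ?N b <#>\<^bsub>G\<^esub> x c = x b"
  have coset1: "{\<one>\<^bsub>G\<^esub>} #>\<^bsub>G\<^esub> t = {t}" if "t \<in> carrier G" for t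
    using that by (simp add: r_coset_def)
  obtain s where s: "s \<in> carrier G" "x b = {s}"
    using x(1)[OF b(1)] coset1 by (auto simp: b(2) carrier_FactGroup)
  show "\<exists>s\<in>carrier G. \<forall>c\<in>Field l. x c = ?N c #>\<^bsub>G\<^esub> s"
  proof (intro bexI ballI)
    fix c assume c: "c \<in> Field l"
    consider "(c, b) \<in> l" | "(b, c) \<in> l" using TOTALS b c by blast
    then show "x c = ?N c #>\<^bsub>G\<^esub> s"
    proof cases
      case 1
      have "x c = ?N c <#>\<^bsub>G\<^esub> {s}" using x(2)[OF 1] s(2) by simp
      then show ?thesis by (simp add: set_mult_def r_coset_def)
    next
      case 2
      have "?N c = {\<one>\<^bsub>G\<^esub>}"
        using iter_power_antimono[OF G wo 2, of p] subgroup.one_closed[OF subgroup_iter_power[OF G wo]]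
        by (fastforce simp: b(2))
      moreover from this obtain t where t: "t \<in> carrier G" "x c = {t}"
        using x(1)[OF c] coset1 by (auto simp: carrier_FactGroup)
      moreover have "t = s" using x(2)[OF 2] s t by (simp add: b(2) set_mult_def)
      ultimately show ?thesis using coset1 by simp
    qed
  qed (rule s(1))
qed

lemma monotone_sequence_above:
  assumes wo: "Well_order l" and h: "\<And>n::nat. h n \<in> Field l"
  obtains g where "\<And>n. (h n, g n) \<in> l" "\<And>n. (g n, g (Suc n)) \<in> l"
proof -
  interpret wo_rel l by (rule wo_rel.intro) fact
  define g where "g = rec_nat (h 0) (\<lambda>n u. max2 u (h (Suc n)))"
  have g: "g 0 = h 0" "g (Suc n) = max2 (g n) (h (Suc n))" for n by (simp_all add: g_def)
  have F: "g n \<in> Field l" for n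
    by (induction n) (simp_all add: g h max2_def)
  have "(h n, g n) \<in> l" for n
    using h REFL max2_greater[OF F h] by (cases n) (auto simp: g refl_on_def)
  moreover have "(g n, g (Suc n)) \<in> l" for n
    using max2_greater[OF F h] by (auto simp: g)
  ultimately show thesis by (rule that)
qed

text \<open>Countability supplies a cofinal sequence \<open>g\<close>. Successive representatives
  have to differ by p^n c_n with c_n in \<open>p^(g n) G\<close>, so they are taken at indices
  \<open>d n\<close> sufficiently far beyond \<open>g n\<close>.\<close>

lemma complete_power_seq_countable:
  fixes G :: "'g monoid" and l :: "'l rel"
  assumes G: "comm_group G" and tel: "telescopic p G" and red: "power_reduced p G"
    and lim: "limit_ordinal l" and count: "countable (Field l)"
  shows "complete_seq l (power_seq p G)"
proof -
  interpret comm_group G by fact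
  have wo: "Well_order l" and ne: "Field l \<noteq> {}" using lim by (auto simp: limit_ordinal_def)
  interpret wo_rel l by (rule wo_rel.intro) fact
  let ?N = "iter_power l p G"
  \<comment> \<open>The index \<open>d\<close> is reached from \<open>b\<close> by \<open>n\<close>
    strict steps upwards, each of which yields one p-th root; a limit ordinal leaves room for
    them.\<close>
  have divisible: "\<exists>d. (b, d) \<in> l \<and> (\<forall>x\<in>?N d. \<exists>c\<in>?N b. x = c [^]\<^bsub>G\<^esub> (p ^ n))"
    if b: "b \<in> Field l" for b n
  proof (induction n)
    case 0
    have "(b, b) \<in> l" using b REFL by (simp add: refl_on_def)
    moreover have "x = x [^]\<^bsub>G\<^esub> (p ^ 0)" if "x \<in> ?N b" for x
      using that iter_power_carrier[OF G wo] by fastforce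
    ultimately show ?case by blast
  next
    case (Suc n)
    then obtain d where d: "(b, d) \<in> l" "\<forall>x\<in>?N d. \<exists>c\<in>?N b. x = c [^]\<^bsub>G\<^esub> (p ^ n)" by blast
    then have "d \<in> Field l" by (auto simp: Field_def)
    then obtain e where e: "d \<in> underS e"
      using limit_ordinal_exists_greater[OF lim] by blast
    have "\<exists>c\<in>?N b. x = c [^]\<^bsub>G\<^esub> (p ^ Suc n)" if x: "x \<in> ?N e" for x
    proof -
      obtain y where y: "y \<in> ?N d" "x = y [^]\<^bsub>G\<^esub> p"
        using x e iter_power_iff[OF G wo, of x p e] by blast
      then obtain c where c: "c \<in> ?N b" "y = c [^]\<^bsub>G\<^esub> (p ^ n)" using d by blast
      then have "x = c [^]\<^bsub>G\<^esub> (p ^ Suc n)"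
        using y iter_power_carrier[OF G wo, of p b] by (auto simp: nat_pow_pow mult.commute)
      then show ?thesis using c by blast
    qed
    moreover have "(b, e) \<in> l" using d(1) e TRANS by (auto simp: underS_def dest: transD)
    ultimately show ?case by blast
  qed
  \<comment> \<open>\<open>e\<close> enumerates the ordinals below \<lambda> and the monotone
    \<open>g\<close> dominates it. Elements of \<open>p^(d' n) G\<close> have p^n-th roots in
    \<open>p^(g n) G\<close>, and \<open>d\<close> is a monotone sequence above
    \<open>d'\<close>.\<close>
  obtain e :: "nat \<Rightarrow> 'l" where e: "range e = Field l"
    using count ne by (metis range_from_nat_into)
  have eF: "e n \<in> Field l" for n using e by blast
  obtain g where g: "\<And>n. (e n, g n) \<in> l" "\<And>n. (g n, g (Suc n)) \<in> l"
    by (rule monotone_sequence_above[of l e, OF wo eF]) (rule that)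
  have "g n \<in> Field l" for n using g(1)[of n] by (auto simp: Field_def)
  from divisible[OF this] have "\<forall>n. \<exists>d. (g n, d) \<in> l \<and>
      (\<forall>x\<in>?N d. \<exists>c\<in>?N (g n). x = c [^]\<^bsub>G\<^esub> (p ^ n))" by blast
  from choice[OF this] obtain d' where d': "\<And>n. (g n, d' n) \<in> l"
    "\<And>n x. x \<in> ?N (d' n) \<Longrightarrow> \<exists>c\<in>?N (g n). x = c [^]\<^bsub>G\<^esub> (p ^ n)"
    by blast
  have d'F: "d' n \<in> Field l" for n using d'(1)[of n] by (auto simp: Field_def)
  obtain d where d: "\<And>n. (d' n, d n) \<in> l" "\<And>n. (d n, d (Suc n)) \<in> l"
    by (rule monotone_sequence_above[of l d', OF wo d'F]) (rule that)
  have dF: "d n \<in> Field l" for n using d(1)[of n] by (auto simp: Field_def)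
  show ?thesis
  proof (rule complete_power_seqI[OF G wo])
    fix x assume x: "\<And>b. b \<in> Field l \<Longrightarrow> x b \<in> carrier (G Mod ?N b)"
      "\<And>b c. (b, c) \<in> l \<Longrightarrow> ?N b <#>\<^bsub>G\<^esub> x c = x b"
    have "\<exists>s\<in>carrier G. x (d n) = ?N (d n) #>\<^bsub>G\<^esub> s" for n
      using x(1)[OF dF] by (auto simp: carrier_FactGroup)
    then obtain s where s: "\<And>n. s n \<in> carrier G" "\<And>n. x (d n) = ?N (d n) #>\<^bsub>G\<^esub> s n" by metis
    have sub: "subgroup (?N b) G" for b by (rule subgroup_iter_power[OF G wo])
    have self: "s n \<in> x (d n)" for n
      unfolding s(2) by (rule rcos_self[OF s(1) sub])
    \<comment> \<open>Projection only enlarges cosets, so a representative at \<open>c\<close> is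
      also one at every smaller \<open>b\<close>.\<close>
    have mem: "t \<in> x b" if "(b, c) \<in> l" "t \<in> x c" "t \<in> carrier G" for b c t
    proof -
      have "\<one>\<^bsub>G\<^esub> \<otimes>\<^bsub>G\<^esub> t \<in> ?N b <#>\<^bsub>G\<^esub> x c"
        using that(2) subgroup.one_closed[OF sub] unfolding set_mult_def by blast
      then show ?thesis using x(2)[OF that(1)] that(3) by simp
    qed
    have "\<exists>c. c \<in> ?N (g n) \<and> s (Suc n) = s n \<otimes>\<^bsub>G\<^esub> c [^]\<^bsub>G\<^esub> (p ^ n)" for n
    proof -
      have "s (Suc n) \<in> x (d n)" by (rule mem[OF d(2) self s(1)])
      then obtain h where h: "h \<in> ?N (d n)" "s (Suc n) = h \<otimes>\<^bsub>G\<^esub> s n"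
        unfolding s(2) by (auto simp: r_coset_def)
      then have "h \<in> ?N (d' n)" using iter_power_antimono[OF G wo d(1)] by blast
      then obtain c where c: "c \<in> ?N (g n)" "h = c [^]\<^bsub>G\<^esub> (p ^ n)" using d'(2) by blast
      then have "c \<in> carrier G" using iter_power_carrier[OF G wo] by blast
      then show ?thesis using c h s(1) by (auto simp: m_comm)
    qed
    then obtain c where c: "\<And>n. c n \<in> ?N (g n)" "\<And>n. s (Suc n) = s n \<otimes>\<^bsub>G\<^esub> c n [^]\<^bsub>G\<^esub> (p ^ n)"
      by metis
    obtain u where u: "u \<in> carrier G" "\<And>n. \<exists>y\<in>?N (g n). u = y \<otimes>\<^bsub>G\<^esub> s n"
      by (rule iter_power_limit_of_sequence[OF G wo tel red g(2) c(1) s(1) c(2)]) (rule that)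
    have "x b = ?N b #>\<^bsub>G\<^esub> u" if b: "b \<in> Field l" for b
    proof -
      obtain n where n: "b = e n" using b e by blast
      then have bg: "(b, g n) \<in> l" using g(1) by simp
      then have "(b, d n) \<in> l" using d'(1) d(1) TRANS by (meson transD)
      from mem[OF this self s(1)] have sx: "s n \<in> x b" .
      obtain t where t: "t \<in> carrier G" "x b = ?N b #>\<^bsub>G\<^esub> t"
        using x(1)[OF b] by (auto simp: carrier_FactGroup)
      obtain y where "y \<in> ?N b" "u = y \<otimes>\<^bsub>G\<^esub> s n"
        using u(2) iter_power_antimono[OF G wo bg] by blast
      moreover obtain z where "z \<in> ?N b" "s n = z \<otimes>\<^bsub>G\<^esub> t"
        using sx unfolding t(2) by (auto simp: r_coset_def)
      moreover have Nb: "?N b \<subseteq> carrier G" by (rule iter_power_carrier[OF G wo])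
      ultimately have "u = (y \<otimes>\<^bsub>G\<^esub> z) \<otimes>\<^bsub>G\<^esub> t" "y \<otimes>\<^bsub>G\<^esub> z \<in> ?N b"
        using t(1) subgroup.m_closed[OF sub] m_assoc[OF subsetD[OF Nb] subsetD[OF Nb] t(1)]
        by simp_all
      then have "u \<in> ?N b #>\<^bsub>G\<^esub> t" by (auto simp: r_coset_def)
      from repr_independence[OF this t(1) sub] show ?thesis using t(2) by simp
    qed
    then show "\<exists>s\<in>carrier G. \<forall>b\<in>Field l. x b = ?N b #>\<^bsub>G\<^esub> s" using u(1) by blast
  qed
qed

section \<open>Comparison with \<open>\<aleph>\<^sub>1\<close>\<close>

lemma card_less_aleph1_iff: "|S| <o aleph1 \<longleftrightarrow> countable S"
proof -
  have "|S| <o aleph1 \<longleftrightarrow> |S| \<le>o natLeq"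
    by (rule cardSuc_ordLeq_ordLess[OF natLeq_Card_order card_of_Card_order])
  also have "\<dots> \<longleftrightarrow> |S| \<le>o |UNIV :: nat set|"
    using card_of_nat ordLeq_ordIso_trans ordIso_symmetric by blast
  also have "\<dots> \<longleftrightarrow> countable S"
    by (simp add: countable_def card_of_ordLeq[symmetric])
  finally show ?thesis .
qed

lemma countable_underS_aleph1: "countable (underS aleph1 a)"
proof (cases "a \<in> Field aleph1")
  case True
  have "Card_order aleph1" by (rule cardSuc_Card_order[OF natLeq_Card_order])
  from card_of_underS[OF this True] show ?thesis by (simp add: card_less_aleph1_iff)
next
  case False
  then have "underS aleph1 a = {}" by (auto simp: underS_def Field_def)
  then show ?thesis by simp
qed

lemma uncountable_Field_aleph1: "\<not> countable (Field aleph1)"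
proof
  assume "countable (Field aleph1)"
  then have "|Field aleph1| <o aleph1" by (simp add: card_less_aleph1_iff)
  moreover have "|Field aleph1| =o aleph1"
    by (rule card_of_Field_ordIso) (rule cardSuc_Card_order[OF natLeq_Card_order])
  ultimately show False using not_ordLess_ordIso by blast
qed

lemma countable_Field_of_less_aleph1:
  assumes "l <o aleph1"
  shows "countable (Field l)"
proof -
  have "well_order_on (Field l) l" using ordLess_Well_order_simp[OF assms] by (rule conjunct1)
  then have "|Field l| \<le>o l" by (rule card_of_least)
  from ordLeq_ordLess_trans[OF this assms] show ?thesis by (simp add: card_less_aleph1_iff)
qed

text \<open>A smaller ordinal is isomorphic to a proper initial segment. Of the isomorphism only
  strict monotonicity is kept, as \<open>iter_power_strict_mono_subset\<close> asks for.\<close>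

lemma strict_mono_below_of_less:
  assumes "r <o s"
  obtains f b where "b \<in> Field s" "\<And>a. a \<in> Field r \<Longrightarrow> f a \<in> underS s b"
    "\<And>a c. c \<in> underS r a \<Longrightarrow> f c \<in> underS s (f a)"
proof -
  have wo: "Well_order r" "Well_order s" using ordLess_Well_order_simp[OF assms] by blast+
  obtain b where b: "b \<in> Field s" "r =o Restr s (underS s b)"
    using iffD1[OF ordLess_iff_ordIso_Restr[OF wo(2,1)] assms] by (rule bexE)
  then obtain f where f: "BNF_Wellorder_Embedding.iso r (Restr s (underS s b)) f"
    unfolding ordIso_def by blast
  have bij: "bij_betw f (Field r) (Field (Restr s (underS s b)))"
    using f by (simp add: BNF_Wellorder_Embedding.iso_def)
  have wR: "Well_order (Restr s (underS s b))" by (rule Well_order_Restr[OF wo(2)])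
  have iff: "(x, y) \<in> r \<longleftrightarrow> (f x, f y) \<in> Restr s (underS s b)" if "x \<in> Field r" "y \<in> Field r" for x y
    using f iso_iff2[of r "Restr s (underS s b)" f] that by blast
  have "f a \<in> underS s b" if "a \<in> Field r" for a
  proof -
    have "Field (Restr s (underS s b)) \<subseteq> underS s b" by (auto simp: Field_def)
    then show ?thesis using bij_betwE[OF bij] that by blast
  qed
  moreover have "f c \<in> underS s (f a)" if "c \<in> underS r a" for a c
  proof -
    have *: "(c, a) \<in> r" "c \<noteq> a" "c \<in> Field r" "a \<in> Field r"
      using that by (auto simp: underS_def Field_def)
    then have "f c \<noteq> f a" using bij by (auto simp: bij_betw_def inj_on_def)
    then show ?thesis using iff * by (auto simp: underS_def)
  qed
  ultimately show thesis using that b(1) by blast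
qed

section \<open>Countably supported products\<close>

context
  fixes I :: "'x set" and E :: "'x \<Rightarrow> 'g monoid" and A
  assumes E: "\<And>x. x \<in> I \<Longrightarrow> comm_group (E x)"
  defines "A \<equiv> supported_product aleph1 I E"
begin

lemma carrier_supported_product:
  "carrier A = {f \<in> (\<Pi>\<^sub>E x\<in>I. carrier (E x)). countable {x \<in> I. f x \<noteq> \<one>\<^bsub>E x\<^esub>}}"
  by (simp add: A_def supported_product_def card_less_aleph1_iff)

lemma mult_supported_product: "f \<otimes>\<^bsub>A\<^esub> g = (\<lambda>x\<in>I. f x \<otimes>\<^bsub>E x\<^esub> g x)"
  by (simp add: A_def supported_product_def)

lemma one_supported_product: "\<one>\<^bsub>A\<^esub> = (\<lambda>x\<in>I. \<one>\<^bsub>E x\<^esub>)"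
  by (simp add: A_def supported_product_def)

lemma comm_group_supported_product: "comm_group A"
  unfolding A_def by (rule supported_product_comm_group[OF Cinfinite_cardSuc[OF natLeq_Cinfinite] E])

lemma pow_supported_product: "f [^]\<^bsub>A\<^esub> (n::nat) = (\<lambda>x\<in>I. f x [^]\<^bsub>E x\<^esub> n)"
  by (induction n) (simp_all add: one_supported_product mult_supported_product nat_pow_def fun_eq_iff)

lemma telescopic_supported_product:
  assumes tel: "\<And>x. x \<in> I \<Longrightarrow> telescopic p (E x)"
  shows "telescopic p A"
  unfolding telescopic_def
proof
  fix c :: "nat \<Rightarrow> _" assume "c \<in> UNIV \<rightarrow> carrier A"
  then have c: "c (i::nat) \<in> carrier A" for i by blast
  have cx: "(\<lambda>i. c i x) \<in> UNIV \<rightarrow> carrier (E x)" if "x \<in> I" for x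
    using c that by (auto simp: carrier_supported_product)
  have "\<forall>x\<in>I. \<exists>a\<in>UNIV \<rightarrow> carrier (E x). \<forall>i. a i = c i x \<otimes>\<^bsub>E x\<^esub> a (Suc i) [^]\<^bsub>E x\<^esub> p"
    using bspec[OF tel[unfolded telescopic_def] cx] by simp
  then obtain a where a: "\<And>x i. x \<in> I \<Longrightarrow> a x i \<in> carrier (E x)"
      "\<And>x i. x \<in> I \<Longrightarrow> a x i = c i x \<otimes>\<^bsub>E x\<^esub> a x (Suc i) [^]\<^bsub>E x\<^esub> p"
    by (metis PiE UNIV_I)
  \<comment> \<open>All constants are trivial outside the countable set \<open>K\<close>. The
    solution is set to be trivial there too, which keeps its support countable.\<close>
  define K where "K = (\<Union>i. {x \<in> I. c i x \<noteq> \<one>\<^bsub>E x\<^esub>})"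
  define b where "b = (\<lambda>i. \<lambda>x\<in>I. if x \<in> K then a x i else \<one>\<^bsub>E x\<^esub>)"
  have "countable K" using c by (auto simp: K_def carrier_supported_product)
  then have "countable {x \<in> I. b i x \<noteq> \<one>\<^bsub>E x\<^esub>}" for i
    by (rule countable_subset[rotated]) (auto simp: b_def)
  moreover have "b i \<in> (\<Pi>\<^sub>E x\<in>I. carrier (E x))" for i
    using a(1) E by (auto simp: b_def comm_group.axioms group.is_monoid)
  ultimately have "b \<in> UNIV \<rightarrow> carrier A" by (auto simp: carrier_supported_product)
  moreover have "b i = c i \<otimes>\<^bsub>A\<^esub> b (Suc i) [^]\<^bsub>A\<^esub> p" for i
  proof
    fix x
    show "b i x = (c i \<otimes>\<^bsub>A\<^esub> b (Suc i) [^]\<^bsub>A\<^esub> p) x"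
    proof (cases "x \<in> I")
      case True
      then interpret comm_group "E x" by (rule E)
      show ?thesis
      proof (cases "x \<in> K")
        case xK: True
        have "b i x = c i x \<otimes>\<^bsub>E x\<^esub> a x (Suc i) [^]\<^bsub>E x\<^esub> p"
          using True xK a(2)[OF True, of i] by (simp add: b_def)
        then show ?thesis
          using True xK by (simp add: mult_supported_product pow_supported_product b_def)
      next
        case False
        then have "c i x = \<one>\<^bsub>E x\<^esub>" using True by (auto simp: K_def)
        then show ?thesis
          using True False by (simp add: mult_supported_product pow_supported_product b_def)
      qed
    qed (simp add: b_def mult_supported_product)
  qed
  ultimately show "\<exists>a\<in>UNIV \<rightarrow> carrier A. \<forall>i. a i = c i \<otimes>\<^bsub>A\<^esub> a (Suc i) [^]\<^bsub>A\<^esub> p" by blast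
qed

lemma power_reduced_supported_product:
  assumes red: "\<And>x. x \<in> I \<Longrightarrow> power_reduced p (E x)"
  shows "power_reduced p A"
  unfolding power_reduced_def
proof (intro ballI impI allI)
  fix a i assume a: "a \<in> UNIV \<rightarrow> carrier A" "\<forall>i. a i = a (Suc i) [^]\<^bsub>A\<^esub> p"
  have ai: "a i \<in> carrier A" for i using a(1) by blast
  have "a i x = \<one>\<^bsub>E x\<^esub>" if x: "x \<in> I" for x
  proof -
    have "(\<lambda>i. a i x) \<in> UNIV \<rightarrow> carrier (E x)"
      using ai x by (auto simp: carrier_supported_product)
    moreover have "a i x = a (Suc i) x [^]\<^bsub>E x\<^esub> p" for i
      using fun_cong[OF spec[OF a(2), of i], of x] x by (simp add: pow_supported_product)
    ultimately show ?thesis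
      using red[OF x, unfolded power_reduced_def, rule_format, of "\<lambda>i. a i x" i] by blast
  qed
  then show "a i = \<one>\<^bsub>A\<^esub>"
    using ai[of i] by (auto simp: fun_eq_iff one_supported_product carrier_supported_product
        PiE_def extensional_def)
qed

lemma iter_power_supported_product_iff:
  assumes wo: "Well_order r"
  shows "f \<in> iter_power r p A b \<longleftrightarrow>
    f \<in> carrier A \<and> (\<forall>x\<in>I. f x \<in> iter_power r p (E x) b)"
proof -
  interpret wo_rel r by (rule wo_rel.intro) fact
  note A = comm_group_supported_product
  have "\<forall>f. f \<in> iter_power r p A b \<longleftrightarrow>
    f \<in> carrier A \<and> (\<forall>x\<in>I. f x \<in> iter_power r p (E x) b)"
  proof (induction b rule: well_order_induct)
    case (1 b)
    then have IH: "f \<in> iter_power r p A d \<longleftrightarrow>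
        f \<in> carrier A \<and> (\<forall>x\<in>I. f x \<in> iter_power r p (E x) d)" if "d \<in> underS b" for f d
      using that by (auto simp: underS_def)
    show ?case
    proof (intro allI iffI conjI ballI)
      fix f assume f: "f \<in> iter_power r p A b"
      then show fA: "f \<in> carrier A" using iter_power_carrier[OF A wo] by blast
      fix x assume x: "x \<in> I"
      have "\<exists>y\<in>iter_power r p (E x) d. f x = y [^]\<^bsub>E x\<^esub> p" if d: "d \<in> underS b" for d
      proof -
        obtain g where "g \<in> iter_power r p A d" "f = g [^]\<^bsub>A\<^esub> p"
          using f d iter_power_iff[OF A wo, of f p b] by blast
        then show ?thesis using IH[OF d] x by (auto simp: pow_supported_product)
      qed
      moreover have "f x \<in> carrier (E x)" using fA x by (auto simp: carrier_supported_product)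
      ultimately show "f x \<in> iter_power r p (E x) b"
        using iter_power_iff[OF E[OF x] wo, of "f x" p b] by blast
    next
      fix f assume f: "f \<in> carrier A \<and> (\<forall>x\<in>I. f x \<in> iter_power r p (E x) b)"
      have "\<exists>g\<in>iter_power r p A d. f = g [^]\<^bsub>A\<^esub> p" if d: "d \<in> underS b" for d
      proof -
        have "\<forall>x\<in>I. \<exists>y\<in>iter_power r p (E x) d. f x = y [^]\<^bsub>E x\<^esub> p"
          using f d iter_power_iff[OF E wo] by blast
        then obtain y where y: "\<And>x. x \<in> I \<Longrightarrow> y x \<in> iter_power r p (E x) d"
            "\<And>x. x \<in> I \<Longrightarrow> f x = y x [^]\<^bsub>E x\<^esub> p" by metis
        \<comment> \<open>Trivial coordinates receive the trivial root; arbitrary roots could have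
          uncountable support.\<close>
        define g where "g = (\<lambda>x\<in>I. if f x = \<one>\<^bsub>E x\<^esub> then \<one>\<^bsub>E x\<^esub> else y x)"
        have gd: "g x \<in> iter_power r p (E x) d" if "x \<in> I" for x
          using y(1) that subgroup.one_closed[OF subgroup_iter_power[OF E wo]] by (simp add: g_def)
        have "countable {x \<in> I. f x \<noteq> \<one>\<^bsub>E x\<^esub>}" using f by (simp add: carrier_supported_product)
        then have "countable {x \<in> I. g x \<noteq> \<one>\<^bsub>E x\<^esub>}"
          by (rule countable_subset[rotated]) (auto simp: g_def)
        moreover have "g \<in> (\<Pi>\<^sub>E x\<in>I. carrier (E x))"
          using gd iter_power_carrier[OF E wo] by (fastforce simp: g_def)
        ultimately have "g \<in> iter_power r p A d"
          using IH[OF d] gd by (auto simp: carrier_supported_product)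
        moreover have "f = g [^]\<^bsub>A\<^esub> p"
        proof
          fix x
          show "f x = (g [^]\<^bsub>A\<^esub> p) x"
          proof (cases "x \<in> I")
            case True
            then interpret comm_group "E x" by (rule E)
            show ?thesis
              using True y(2)[OF True] by (simp add: g_def pow_supported_product)
          next
            case False
            then show ?thesis using f
              by (auto simp: pow_supported_product carrier_supported_product PiE_def extensional_def)
          qed
        qed
        ultimately show ?thesis by blast
      qed
      then show "f \<in> iter_power r p A b"
        using f iter_power_iff[OF A wo, of f p b] by blast
    qed
  qed
  then show ?thesis by blast
qed

end

section \<open>Quotients\<close>

lemma iter_power_Mod_image:
  assumes G: "comm_group G" and wo: "Well_order r" and H: "subgroup H G"
    and x: "x \<in> iter_power r p G b"
  shows "H #>\<^bsub>G\<^esub> x \<in> iter_power r p (G Mod H) b"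
proof -
  interpret comm_group G by fact
  interpret normal H G using H by (simp add: normal_iff_subgroup)
  interpret wo_rel r by (rule wo_rel.intro) fact
  note M = comm_group_Mod[OF G H]
  show ?thesis using x
  proof (induction b arbitrary: x rule: well_order_induct)
    case (1 b)
    have "\<exists>y\<in>iter_power r p (G Mod H) d. H #>\<^bsub>G\<^esub> x = y [^]\<^bsub>G Mod H\<^esub> p" if d: "d \<in> underS b" for d
    proof -
      obtain y where y: "y \<in> iter_power r p G d" "x = y [^]\<^bsub>G\<^esub> p"
        using 1(2) d iter_power_iff[OF G wo, of x p b] by blast
      have "d \<noteq> b" "(d, b) \<in> r" using d by (auto simp: underS_def)
      then have "H #>\<^bsub>G\<^esub> y \<in> iter_power r p (G Mod H) d" using 1(1) y(1) by blast
      moreover have "y \<in> carrier G" using y(1) iter_power_carrier[OF G wo] by blast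
      ultimately show ?thesis unfolding y(2) by (metis FactGroup_pow)
    qed
    moreover have "x \<in> carrier G" using 1(2) iter_power_carrier[OF G wo] by blast
    ultimately show ?case
      using iter_power_iff[OF M wo, of "H #>\<^bsub>G\<^esub> x" p b] by (auto simp: carrier_FactGroup)
  qed
qed

text \<open>If the coset of \<open>y\<close> is a root of \<open>C\<close>, an element of
  \<open>C\<close> has the form h + p y with h in \<open>p^a G\<close>. As d < b \<le> a, also h = p
  z with z in \<open>p^d G\<close>, so z + y is a root of that element in
  \<open>p^d G\<close>.\<close>

lemma iter_power_Mod_subset:
  assumes G: "comm_group G" and wo: "Well_order r"
    and C: "C \<in> iter_power r p (G Mod iter_power r p G a) b" and ba: "(b, a) \<in> r"
  shows "C \<subseteq> iter_power r p G b"
proof -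
  interpret comm_group G by fact
  let ?H = "iter_power r p G a"
  have H: "subgroup ?H G" by (rule subgroup_iter_power[OF G wo])
  interpret normal ?H G using H by (simp add: normal_iff_subgroup)
  interpret wo_rel r by (rule wo_rel.intro) fact
  note M = comm_group_Mod[OF G H]
  show ?thesis using C ba
  proof (induction b arbitrary: C rule: well_order_induct)
    case (1 b)
    show ?case
    proof
      fix x assume x: "x \<in> C"
      have "C \<in> carrier (G Mod ?H)" using 1(2) iter_power_carrier[OF M wo] by blast
      then have xG: "x \<in> carrier G" using x subset by (auto simp: carrier_FactGroup r_coset_def)
      have "\<exists>y\<in>iter_power r p G d. x = y [^]\<^bsub>G\<^esub> p" if d: "d \<in> underS b" for d
      proof -
        obtain C' where C': "C' \<in> iter_power r p (G Mod ?H) d" "C = C' [^]\<^bsub>G Mod ?H\<^esub> p"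
          using 1(2) d iter_power_iff[OF M wo, of C p b] by blast
        have "d \<noteq> b" "(d, b) \<in> r" using d by (auto simp: underS_def)
        moreover from this have "(d, a) \<in> r" using 1(3) TRANS by (meson transD)
        ultimately have sub: "C' \<subseteq> iter_power r p G d" using 1(1) C'(1) by blast
        have "C' \<in> carrier (G Mod ?H)" using C'(1) iter_power_carrier[OF M wo] by blast
        then obtain y where y: "y \<in> carrier G" "C' = ?H #>\<^bsub>G\<^esub> y" by (auto simp: carrier_FactGroup)
        then have yd: "y \<in> iter_power r p G d" using sub rcos_self[OF y(1) H] by blast
        have "x \<in> ?H #>\<^bsub>G\<^esub> y [^]\<^bsub>G\<^esub> p" using x C'(2) y FactGroup_pow by simp
        then obtain h where h: "h \<in> ?H" "x = h \<otimes>\<^bsub>G\<^esub> y [^]\<^bsub>G\<^esub> p" by (auto simp: r_coset_def)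
        have "d \<in> underS a" using underS_mono[OF wo 1(3)] d by blast
        then obtain z where z: "z \<in> iter_power r p G d" "h = z [^]\<^bsub>G\<^esub> p"
          using h(1) iter_power_iff[OF G wo, of h p a] by blast
        then have "z \<in> carrier G" using iter_power_carrier[OF G wo] by blast
        then have "x = (z \<otimes>\<^bsub>G\<^esub> y) [^]\<^bsub>G\<^esub> p" using h(2) z(2) y(1) by (simp add: nat_pow_distrib)
        moreover have "z \<otimes>\<^bsub>G\<^esub> y \<in> iter_power r p G d"
          using subgroup.m_closed[OF subgroup_iter_power[OF G wo]] z(1) yd by blast
        ultimately show ?thesis by blast
      qed
      then show "x \<in> iter_power r p G b" using iter_power_iff[OF G wo, of x p b] xG by blast
    qed
  qed
qed

lemma iter_power_Mod_self:
  assumes G: "comm_group G" and wo: "Well_order r" and a: "a \<in> Field r"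
  shows "iter_power r p (G Mod iter_power r p G a) a = {\<one>\<^bsub>G Mod iter_power r p G a\<^esub>}"
proof -
  interpret comm_group G by fact
  let ?H = "iter_power r p G a"
  have H: "subgroup ?H G" by (rule subgroup_iter_power[OF G wo])
  interpret wo_rel r by (rule wo_rel.intro) fact
  note M = comm_group_Mod[OF G H]
  have aa: "(a, a) \<in> r" using a REFL by (simp add: refl_on_def)
  have "C = ?H" if C: "C \<in> iter_power r p (G Mod ?H) a" for C
  proof -
    have "C \<in> carrier (G Mod ?H)" using C iter_power_carrier[OF M wo] by blast
    then obtain y where y: "y \<in> carrier G" "C = ?H #>\<^bsub>G\<^esub> y" by (auto simp: carrier_FactGroup)
    moreover have "y \<in> ?H"
      using iter_power_Mod_subset[OF G wo C aa] rcos_self[OF y(1) H] y(2) by blast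
    ultimately show ?thesis using coset_join2[OF y(1) H] by simp
  qed
  moreover have "?H \<in> iter_power r p (G Mod ?H) a"
    using subgroup.one_closed[OF subgroup_iter_power[OF M wo]] by simp
  ultimately show ?thesis by auto
qed

section \<open>The \<open>p\<close>-adic integers\<close>

lemma padic_int_simps:
  "x \<oplus>\<^bsub>padic_int p\<^esub> y = (\<lambda>n. (x n + y n) mod int p ^ n)"
  "x \<otimes>\<^bsub>padic_int p\<^esub> y = (\<lambda>n. x n * y n mod int p ^ n)"
  "\<zero>\<^bsub>padic_int p\<^esub> = (\<lambda>n. 0)"
  "\<one>\<^bsub>padic_int p\<^esub> = (\<lambda>n. 1 mod int p ^ n)"
  by (simp_all add: padic_int_def)

lemma padic_int_mod:
  assumes "x \<in> carrier (padic_int p)"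
  shows "x n mod int p ^ n = x n" "x (Suc n) mod int p ^ n = x n"
  using assms by (auto simp: padic_int_def)

lemma padic_int_modI:
  assumes "p > 0" "\<And>n. f (Suc n) mod int p ^ n = f n mod int p ^ n"
  shows "(\<lambda>n. f n mod int p ^ n) \<in> carrier (padic_int p)"
proof -
  have "f (Suc n) mod int p ^ Suc n mod int p ^ n = f n mod int p ^ n" for n
    using assms(2) mod_mod_cancel[of "int p ^ n" "int p ^ Suc n" "f (Suc n)"] by simp
  then show ?thesis using assms(1) by (simp add: padic_int_def del: power_Suc)
qed

lemma padic_int_pow:
  assumes "x \<in> carrier (padic_int p)"
  shows "x [^]\<^bsub>add_monoid (padic_int p)\<^esub> (k::nat) = (\<lambda>n. int k * x n mod int p ^ n)"
  by (induction k) (simp_all add: nat_pow_def padic_int_simps mod_simps algebra_simps)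

lemma padic_int_torsion_free:
  assumes p: "p > 0" and x: "x \<in> carrier (padic_int p)" and px: "\<And>n. int p * x n mod int p ^ n = 0"
  shows "x = (\<lambda>n. 0)"
proof
  fix n
  \<comment> \<open>Cancelling \<open>p\<close> costs one power of \<open>p\<close>, which is why
    the residue at level \<open>Suc n\<close> is used.\<close>
  have "int p * int p ^ n dvd int p * x (Suc n)"
    using px[of "Suc n"] by (simp add: mod_eq_0_iff_dvd)
  then have "x (Suc n) mod int p ^ n = 0" using p by (simp add: mod_eq_0_iff_dvd)
  then show "x n = 0" using padic_int_mod(2)[OF x, of n] by simp
qed

lemma telescopic_padic_int:
  assumes p: "p > 0"
  shows "telescopic p (add_monoid (padic_int p))"
  unfolding telescopic_def
proof
  fix c :: "nat \<Rightarrow> nat \<Rightarrow> int" assume "c \<in> UNIV \<rightarrow> carrier (add_monoid (padic_int p))"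
  then have c: "c i \<in> carrier (padic_int p)" for i by auto
  \<comment> \<open>\<open>a i\<close> is the p-adic limit of the sum of all p^k c_(i+k); modulo p^n
    only the terms with k < n contribute.\<close>
  define a where "a = (\<lambda>i n. (\<Sum>k<n. int p ^ k * c (i + k) n) mod int p ^ n)"
  have a: "a i \<in> carrier (padic_int p)" for i
    unfolding a_def
  proof (rule padic_int_modI[OF p])
    fix n
    let ?q = "int p ^ n"
    have "(\<Sum>k<Suc n. int p ^ k * c (i + k) (Suc n)) mod ?q
        = (\<Sum>k<n. int p ^ k * c (i + k) (Suc n)) mod ?q" by simp
    also have "\<dots> = (\<Sum>k<n. (int p ^ k * c (i + k) (Suc n)) mod ?q) mod ?q"
      by (simp add: mod_sum_eq)
    also have "\<dots> = (\<Sum>k<n. (int p ^ k * c (i + k) n) mod ?q) mod ?q"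
      by (metis (no_types, lifting) mod_mult_right_eq padic_int_mod(2)[OF c])
    also have "\<dots> = (\<Sum>k<n. int p ^ k * c (i + k) n) mod ?q"
      by (simp add: mod_sum_eq)
    finally show "(\<Sum>k<Suc n. int p ^ k * c (i + k) (Suc n)) mod ?q =
      (\<Sum>k<n. int p ^ k * c (i + k) n) mod ?q" .
  qed
  have eq: "a i n = (c i n + (int p * a (Suc i) n) mod int p ^ n) mod int p ^ n" for i n
  proof -
    \<comment> \<open>The additional term k = n vanishes modulo p^n and makes room for splitting off
      the term k = 0.\<close>
    have "(\<Sum>k<n. int p ^ k * c (i + k) n) mod int p ^ n
        = (\<Sum>k<Suc n. int p ^ k * c (i + k) n) mod int p ^ n" by simp
    also have "\<dots> = (c i n + int p * (\<Sum>k<n. int p ^ k * c (Suc i + k) n)) mod int p ^ n"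
      by (subst sum.lessThan_Suc_shift) (simp add: sum_distrib_left mult.assoc)
    finally show ?thesis by (simp add: a_def mod_simps)
  qed
  show "\<exists>a\<in>UNIV \<rightarrow> carrier (add_monoid (padic_int p)). \<forall>i.
      a i = c i \<otimes>\<^bsub>add_monoid (padic_int p)\<^esub> a (Suc i) [^]\<^bsub>add_monoid (padic_int p)\<^esub> p"
  proof (intro bexI allI)
    fix i
    show "a i = c i \<otimes>\<^bsub>add_monoid (padic_int p)\<^esub> a (Suc i) [^]\<^bsub>add_monoid (padic_int p)\<^esub> p"
      unfolding padic_int_pow[OF a] using eq[of i] by (simp add: padic_int_simps fun_eq_iff)
  qed (use a in simp)
qed

lemma power_module_simps:
  "carrier (power_module R I) = I \<rightarrow>\<^sub>E carrier R"
  "x \<oplus>\<^bsub>power_module R I\<^esub> y = (\<lambda>s\<in>I. x s \<oplus>\<^bsub>R\<^esub> y s)"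
  "\<zero>\<^bsub>power_module R I\<^esub> = (\<lambda>s\<in>I. \<zero>\<^bsub>R\<^esub>)"
  "z \<odot>\<^bsub>power_module R I\<^esub> y = (\<lambda>s\<in>I. z \<otimes>\<^bsub>R\<^esub> y s)"
  by (simp_all add: power_module_def)

lemma power_module_pow:
  "x [^]\<^bsub>add_monoid (power_module R I)\<^esub> (k::nat) = (\<lambda>s\<in>I. x s [^]\<^bsub>add_monoid R\<^esub> k)"
  by (induction k) (simp_all add: nat_pow_def power_module_simps fun_eq_iff)

lemma telescopic_power_module:
  assumes tel: "telescopic p (add_monoid R)"
  shows "telescopic p (add_monoid (power_module R I))"
  unfolding telescopic_def
proof
  let ?P = "add_monoid (power_module R I)"
  fix c :: "nat \<Rightarrow> _" assume "c \<in> UNIV \<rightarrow> carrier ?P"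
  then have c: "(\<lambda>i. c i x) \<in> UNIV \<rightarrow> carrier (add_monoid R)" if "x \<in> I" for x
    using that by (auto simp: power_module_simps)
  have "\<forall>x\<in>I. \<exists>a\<in>UNIV \<rightarrow> carrier R. \<forall>i. a i = c i x \<oplus>\<^bsub>R\<^esub> a (Suc i) [^]\<^bsub>add_monoid R\<^esub> p"
    using bspec[OF tel[unfolded telescopic_def] c] by simp
  then obtain a where a: "\<And>x i. x \<in> I \<Longrightarrow> a x i \<in> carrier R"
      "\<And>x i. x \<in> I \<Longrightarrow> a x i = c i x \<oplus>\<^bsub>R\<^esub> a x (Suc i) [^]\<^bsub>add_monoid R\<^esub> p"
    by (metis PiE UNIV_I)
  define b where "b = (\<lambda>i. \<lambda>x\<in>I. a x i)"
  have "b i = c i \<otimes>\<^bsub>?P\<^esub> b (Suc i) [^]\<^bsub>?P\<^esub> p" for i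
  proof
    fix x
    show "b i x = (c i \<otimes>\<^bsub>?P\<^esub> b (Suc i) [^]\<^bsub>?P\<^esub> p) x"
      unfolding power_module_pow using a(2)[of x i]
      by (cases "x \<in> I") (simp_all add: power_module_simps b_def)
  qed
  moreover have "b \<in> UNIV \<rightarrow> carrier ?P" using a(1) by (auto simp: b_def power_module_simps)
  ultimately show "\<exists>a\<in>UNIV \<rightarrow> carrier ?P. \<forall>i. a i = c i \<otimes>\<^bsub>?P\<^esub> a (Suc i) [^]\<^bsub>?P\<^esub> p" by blast
qed

section \<open>The groups \<open>D\<^sub>\<alpha>\<close> and \<open>E\<^sub>\<alpha>\<close>\<close>

lemma finite_linear_max:
  assumes wo: "Well_order r" and "finite V" "V \<noteq> {}" "V \<subseteq> Field r"
  obtains d where "d \<in> V" "\<And>v. v \<in> V \<Longrightarrow> (v, d) \<in> r"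
proof -
  interpret wo_rel r by (rule wo_rel.intro) fact
  have "\<exists>d\<in>V. \<forall>v\<in>V. (v, d) \<in> r"
    using assms(2-4)
  proof (induction V rule: finite_ne_induct)
    case (singleton u)
    then show ?case using REFL by (simp add: refl_on_def)
  next
    case (insert u V)
    then obtain d where d: "d \<in> V" "\<forall>v\<in>V. (v, d) \<in> r" by auto
    then have F: "u \<in> Field r" "d \<in> Field r" using insert.prems by auto
    have m: "(u, max2 u d) \<in> r" "(d, max2 u d) \<in> r" using max2_greater[OF F] by auto
    moreover have "max2 u d \<in> insert u V" using d by (auto simp: max2_def)
    moreover have "(v, max2 u d) \<in> r" if "v \<in> V" for v
      using d(2) that m(2) TRANS by (meson transD)
    ultimately show ?case by blast
  qed
  then show thesis using that by blast
qed

lemma Ints_mod_mult: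
  assumes "real_of_int q * y \<in> \<int>"
  shows "real_of_int (m mod q) * y - real_of_int m * y \<in> \<int>"
proof -
  have "m mod q - m = - (m div q) * q" by (simp add: minus_div_mult_eq_mod[symmetric])
  then have "real_of_int (m mod q) * y - real_of_int m * y = real_of_int (- (m div q)) * (real_of_int q * y)"
    by (metis (no_types, lifting) left_diff_distrib mult.assoc of_int_diff of_int_mult)
  then show ?thesis using assms by (metis Ints_mult Ints_of_int)
qed

lemma sum_diff_Ints:
  assumes "\<And>s. s \<in> T \<Longrightarrow> f s - g s \<in> (\<int> :: real set)"
  shows "sum f T \<in> \<int> \<longleftrightarrow> sum g T \<in> \<int>"
proof -
  have "sum f T - sum g T \<in> \<int>"
    using assms by (simp add: sum_subtractf[symmetric] Ints_sum)
  then show ?thesis by (metis Ints_diff Ints_add diff_add_cancel diff_diff_eq2 add_diff_cancel_left')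
qed

text \<open>A functional on \<open>P'\<^sub>\<alpha>/R\<^sub>\<alpha>\<close> with values in \<open>\<int>[1/p]/\<int>\<close> is given by real representatives of its values
  on the basis vectors; the empty list stands for \<open>0\<close>, so that the two kinds of relations
  \<open>r\<^sub>\<sigma>\<close> are treated alike.\<close>

definition compatible :: "'o rel \<Rightarrow> nat \<Rightarrow> 'o \<Rightarrow> ('o list \<Rightarrow> real) \<Rightarrow> bool" where
  "compatible r p a \<phi> \<longleftrightarrow> \<phi> [] = 0 \<and>
     (\<forall>b s. b # s \<in> diamond r a \<longrightarrow> real p * \<phi> (b # s) - \<phi> s \<in> \<int>)"

text \<open>By \<open>basis_in_iter_power\<close>, a basis vector whose first entry is at least
  \<open>b\<close> lies in \<open>p^b D\<close>. So this is a necessary condition for a functional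
  to kill \<open>p^b D\<close>; \<open>annihilates_of_iter_power\<close> shows that on finitely
  supported elements it suffices.\<close>

definition vanishes_from :: "'o rel \<Rightarrow> 'o \<Rightarrow> 'o \<Rightarrow> ('o list \<Rightarrow> real) \<Rightarrow> bool" where
  "vanishes_from r a b \<phi> \<longleftrightarrow> (\<forall>c s. c # s \<in> diamond r a \<longrightarrow> (b, c) \<in> r \<longrightarrow> \<phi> (c # s) \<in> \<int>)"

definition vec_support :: "'o rel \<Rightarrow> 'o \<Rightarrow> ('o list \<Rightarrow> nat \<Rightarrow> int) \<Rightarrow> 'o list set" where
  "vec_support r a x = {s \<in> diamond r a. x s \<noteq> (\<lambda>n. 0)}"

text \<open>The \<open>p\<close>-adic coefficients may be replaced by their residues modulo \<open>p\<^sup>N\<close> once \<open>p\<^sup>N\<close> kills the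
  values of \<open>\<phi>\<close> on the support, which is assumed to be finite: the sum over an infinite set is \<open>0\<close>.\<close>

definition annihilates :: "'o rel \<Rightarrow> 'o \<Rightarrow> ('o list \<Rightarrow> real) \<Rightarrow> ('o list \<Rightarrow> nat \<Rightarrow> int) \<Rightarrow> bool" where
  "annihilates r a \<phi> x \<longleftrightarrow>
     (\<forall>\<^sub>F N in sequentially. (\<Sum>s\<in>vec_support r a x. real_of_int (x s N) * \<phi> s) \<in> \<int>)"

text \<open>Basis vectors and relations have integer coefficients. Writing them in this form reduces
  computations with them to integer arithmetic.\<close>

definition int_vec :: "'o rel \<Rightarrow> nat \<Rightarrow> 'o \<Rightarrow> ('o list \<Rightarrow> int) \<Rightarrow> ('o list \<Rightarrow> nat \<Rightarrow> int)" where
  "int_vec r p a k = (\<lambda>s\<in>diamond r a. \<lambda>n. k s mod int p ^ n)"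

lemma annihilates_iff:
  assumes "finite T" "vec_support r a x \<subseteq> T" "T \<subseteq> diamond r a"
  shows "annihilates r a \<phi> x \<longleftrightarrow> (\<forall>\<^sub>F N in sequentially. (\<Sum>s\<in>T. real_of_int (x s N) * \<phi> s) \<in> \<int>)"
proof -
  have "(\<Sum>s\<in>vec_support r a x. real_of_int (x s N) * \<phi> s) = (\<Sum>s\<in>T. real_of_int (x s N) * \<phi> s)" for N
    using assms by (intro sum.mono_neutral_left) (auto simp: vec_support_def)
  then show ?thesis by (simp add: annihilates_def)
qed

lemma annihilates_cong:
  "(\<And>s. s \<in> vec_support r a x \<Longrightarrow> \<phi> s = \<psi> s) \<Longrightarrow> annihilates r a \<phi> x \<longleftrightarrow> annihilates r a \<psi> x"
  by (simp add: annihilates_def)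

lemma diamond_Cons:
  assumes "b # s \<in> diamond r a"
  shows "b \<in> underS r a" "s = [] \<or> s \<in> diamond r a"
  using assms by (auto simp: diamond_def)

lemma diamond_Cons_Cons:
  "b # c # s \<in> diamond r a \<Longrightarrow> b \<in> underS r c"
  by (auto simp: diamond_def underS_def)

section \<open>Functionals on finitely supported vectors and the relation module\<close>

context
  fixes p :: nat and r :: "'o rel" and a :: 'o
  assumes p: "p > 1" and wo: "Well_order r"
begin

interpretation wo_rel r by (rule wo_rel.intro) (rule wo)

private abbreviation "I \<equiv> diamond r a"
private abbreviation "Z \<equiv> padic_int p"
private abbreviation "P \<equiv> P_mod r p a"

lemma P_module: "module Z P"
  unfolding P_mod_def using p by (intro power_module_module padic_int_cring) simp

lemma carrier_P: "carrier P = I \<rightarrow>\<^sub>E carrier Z"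
  by (simp add: P_mod_def power_module_simps)

lemma add_P: "x \<oplus>\<^bsub>P\<^esub> y = (\<lambda>s\<in>I. \<lambda>n. (x s n + y s n) mod int p ^ n)"
  by (simp add: P_mod_def power_module_simps padic_int_simps)

lemma smult_P: "z \<odot>\<^bsub>P\<^esub> y = (\<lambda>s\<in>I. \<lambda>n. z n * y s n mod int p ^ n)"
  by (simp add: P_mod_def power_module_simps padic_int_simps)

lemma pow_P:
  assumes "x \<in> carrier P"
  shows "x [^]\<^bsub>add_monoid P\<^esub> (k::nat) = (\<lambda>s\<in>I. \<lambda>n. int k * x s n mod int p ^ n)"
proof -
  have "x s [^]\<^bsub>add_monoid Z\<^esub> k = (\<lambda>n. int k * x s n mod int p ^ n)" if "s \<in> I" for s
    using assms that by (intro padic_int_pow) (auto simp: carrier_P)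
  then show ?thesis
    unfolding P_mod_def power_module_pow by (intro restrict_ext) simp
qed

lemma int_vec_closed: "int_vec r p a k \<in> carrier P"
  unfolding int_vec_def carrier_P using p padic_int_modI[of p "\<lambda>n. _"] by auto

lemma vec_support_zero: "vec_support r a \<zero>\<^bsub>P\<^esub> = {}"
  by (auto simp: vec_support_def P_mod_def power_module_simps padic_int_simps)

lemma vec_support_int_vec: "vec_support r a (int_vec r p a k) \<subseteq> {s \<in> I. k s \<noteq> 0}"
  by (auto simp: vec_support_def int_vec_def)

text \<open>Modulo integers, each multiplication by \<open>p\<close> removes the first entry of the
  sequence, until the empty list with value 0 is reached.\<close>

lemma compatible_power_Ints:
  assumes \<phi>: "compatible r p a \<phi>" and "s = [] \<or> s \<in> I" "length s \<le> N"
  shows "real_of_int (int p ^ N) * \<phi> s \<in> \<int>"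
  using assms(2,3)
proof (induction s arbitrary: N)
  case Nil
  then show ?case using \<phi> by (simp add: compatible_def)
next
  case (Cons b s)
  then obtain M where M: "N = Suc M" "length s \<le> M" by (cases N) auto
  have bs: "b # s \<in> I" using Cons.prems by simp
  then have *: "s = [] \<or> s \<in> I" "real p * \<phi> (b # s) - \<phi> s \<in> \<int>"
    using diamond_Cons(2)[OF bs] \<phi> by (auto simp: compatible_def)
  have "real_of_int (int p ^ M) * (real p * \<phi> (b # s) - \<phi> s) + real_of_int (int p ^ M) * \<phi> s \<in> \<int>"
    by (rule Ints_add[OF Ints_mult[OF Ints_of_int *(2)] Cons.IH[OF *(1) M(2)]])
  then show ?case by (simp add: M(1) algebra_simps)
qed

lemma eventually_power_Ints:
  assumes \<phi>: "compatible r p a \<phi>" and T: "finite T" "T \<subseteq> I"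
  shows "\<forall>\<^sub>F N in sequentially. \<forall>s\<in>T. real_of_int (int p ^ N) * \<phi> s \<in> \<int>"
proof -
  have "\<forall>\<^sub>F N in sequentially. real_of_int (int p ^ N) * \<phi> s \<in> \<int>" if "s \<in> T" for s
    using that T compatible_power_Ints[OF \<phi>]
    by (intro eventually_sequentiallyI[of "length s"]) auto
  then show ?thesis using T(1) by (simp add: eventually_ball_finite_distrib)
qed

text \<open>Once p^N kills the values of \<phi> on \<open>T\<close>, residues modulo p^N may be
  replaced by the integers themselves, and the sum no longer depends on \<open>N\<close>.\<close>

lemma annihilates_int_vec:
  assumes \<phi>: "compatible r p a \<phi>" and T: "finite T" "{s \<in> I. k s \<noteq> 0} \<subseteq> T" "T \<subseteq> I"
  shows "annihilates r a \<phi> (int_vec r p a k) \<longleftrightarrow> (\<Sum>s\<in>T. real_of_int (k s) * \<phi> s) \<in> \<int>"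
proof -
  have sup: "vec_support r a (int_vec r p a k) \<subseteq> T" using vec_support_int_vec T(2) by blast
  have "\<forall>\<^sub>F N in sequentially. (\<Sum>s\<in>T. real_of_int (int_vec r p a k s N) * \<phi> s) \<in> \<int> \<longleftrightarrow>
      (\<Sum>s\<in>T. real_of_int (k s) * \<phi> s) \<in> \<int>"
    using eventually_power_Ints[OF \<phi> T(1,3)]
  proof eventually_elim
    case (elim N)
    show ?case
    proof (rule sum_diff_Ints)
      fix s assume s: "s \<in> T"
      then have "int_vec r p a k s N = k s mod int p ^ N" using T(3) by (auto simp: int_vec_def)
      then show "real_of_int (int_vec r p a k s N) * \<phi> s - real_of_int (k s) * \<phi> s \<in> \<int>"
        using elim s by (simp only: Ints_mod_mult)
    qed
  qed
  then have "(\<forall>\<^sub>F N in sequentially. (\<Sum>s\<in>T. real_of_int (int_vec r p a k s N) * \<phi> s) \<in> \<int>) \<longleftrightarrow>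
      (\<forall>\<^sub>F N in sequentially. (\<Sum>s\<in>T. real_of_int (k s) * \<phi> s) \<in> \<int>)"
    by (rule eventually_subst)
  then show ?thesis by (simp add: annihilates_iff[OF T(1) sup T(3)])
qed

text \<open>One computation serves sums, p-adic multiples and equations x = h + p y. The coefficient
  \<open>q\<close> is a sequence of residues so that it can be a p-adic scalar. Only q times the
  value on \<open>z\<close> has to be integral, which in the last case means that p \<phi>
  annihilates y.\<close>

lemma annihilates_lincomb:
  assumes \<phi>: "compatible r p a \<phi>"
    and T: "finite T" "vec_support r a x \<subseteq> T" "vec_support r a y \<subseteq> T" "vec_support r a z \<subseteq> T" "T \<subseteq> I"
    and x: "\<And>s n. s \<in> T \<Longrightarrow> x s n = (y s n + q n * z s n) mod int p ^ n"
    and y: "annihilates r a \<phi> y"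
    and z: "\<forall>\<^sub>F N in sequentially. real_of_int (q N) * (\<Sum>s\<in>T. real_of_int (z s N) * \<phi> s) \<in> \<int>"
  shows "annihilates r a \<phi> x"
  unfolding annihilates_iff[OF T(1,2,5)]
  using eventually_power_Ints[OF \<phi> T(1,5)] y[unfolded annihilates_iff[OF T(1,3,5)]] z
proof eventually_elim
  case (elim N)
  have "(\<Sum>s\<in>T. real_of_int (x s N) * \<phi> s) \<in> \<int> \<longleftrightarrow>
      (\<Sum>s\<in>T. real_of_int (y s N + q N * z s N) * \<phi> s) \<in> \<int>"
    using elim(1) by (intro sum_diff_Ints) (simp only: x Ints_mod_mult)
  also have "(\<Sum>s\<in>T. real_of_int (y s N + q N * z s N) * \<phi> s) =
      (\<Sum>s\<in>T. real_of_int (y s N) * \<phi> s) + real_of_int (q N) * (\<Sum>s\<in>T. real_of_int (z s N) * \<phi> s)"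
    by (simp add: sum.distrib sum_distrib_left algebra_simps)
  finally show ?case using elim(2,3) by (simp add: Ints_add)
qed

text \<open>An upper bound for the relation module. Finiteness keeps out vectors of infinite
  support, which \<open>annihilates\<close> accepts trivially.\<close>

definition null_vecs :: "('o list \<Rightarrow> nat \<Rightarrow> int) set" where
  "null_vecs = {x \<in> carrier P. finite (vec_support r a x) \<and>
     (\<forall>\<phi>. compatible r p a \<phi> \<longrightarrow> annihilates r a \<phi> x)}"

lemma null_vecs_submodule: "submodule null_vecs Z P"
proof -
  interpret module Z P by (rule P_module)
  have supp: "vec_support r a x \<subseteq> I" for x by (auto simp: vec_support_def)
  have zero: "\<zero>\<^bsub>P\<^esub> \<in> null_vecs"
    by (auto simp: null_vecs_def vec_support_zero annihilates_def)
  have add: "x \<oplus>\<^bsub>P\<^esub> y \<in> null_vecs" if x: "x \<in> null_vecs" and y: "y \<in> null_vecs" for x y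
  proof -
    let ?T = "vec_support r a x \<union> vec_support r a y"
    have fin: "finite ?T" using x y by (auto simp: null_vecs_def)
    have sup: "vec_support r a (x \<oplus>\<^bsub>P\<^esub> y) \<subseteq> ?T"
      by (auto simp: vec_support_def add_P)
    have "annihilates r a \<phi> (x \<oplus>\<^bsub>P\<^esub> y)" if \<phi>: "compatible r p a \<phi>" for \<phi>
    proof (rule annihilates_lincomb[OF \<phi> fin sup, where q = "\<lambda>n. 1"])
      show "(x \<oplus>\<^bsub>P\<^esub> y) s n = (x s n + 1 * y s n) mod int p ^ n" if "s \<in> ?T" for s n
        using that supp by (auto simp: add_P)
      show "annihilates r a \<phi> x" using x \<phi> by (simp add: null_vecs_def)
      have "annihilates r a \<phi> y" using y \<phi> by (simp add: null_vecs_def)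
      then show "\<forall>\<^sub>F N in sequentially. real_of_int 1 * (\<Sum>s\<in>?T. real_of_int (y s N) * \<phi> s) \<in> \<int>"
        using annihilates_iff[OF fin, of r a y \<phi>] supp by simp
    qed (use supp in auto)
    then show ?thesis
      using x y finite_subset[OF sup fin] by (auto simp: null_vecs_def)
  qed
  have smult: "z \<odot>\<^bsub>P\<^esub> x \<in> null_vecs" if z: "z \<in> carrier Z" and x: "x \<in> null_vecs" for z x
  proof -
    let ?T = "vec_support r a x"
    have fin: "finite ?T" using x by (auto simp: null_vecs_def)
    have sup: "vec_support r a (z \<odot>\<^bsub>P\<^esub> x) \<subseteq> ?T"
      by (auto simp: vec_support_def smult_P)
    have "annihilates r a \<phi> (z \<odot>\<^bsub>P\<^esub> x)" if \<phi>: "compatible r p a \<phi>" for \<phi>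
    proof (rule annihilates_lincomb[OF \<phi> fin sup, where q = z and y = "\<zero>\<^bsub>P\<^esub>" and z = x])
      show "(z \<odot>\<^bsub>P\<^esub> x) s n = (\<zero>\<^bsub>P\<^esub> s n + z n * x s n) mod int p ^ n" if "s \<in> ?T" for s n
        using that supp[of x] by (auto simp: smult_P P_mod_def power_module_simps padic_int_simps)
      show "annihilates r a \<phi> \<zero>\<^bsub>P\<^esub>" using zero \<phi> by (simp add: null_vecs_def)
      have "annihilates r a \<phi> x" using x \<phi> by (simp add: null_vecs_def)
      then show "\<forall>\<^sub>F N in sequentially. real_of_int (z N) * (\<Sum>s\<in>?T. real_of_int (x s N) * \<phi> s) \<in> \<int>"
        unfolding annihilates_def by eventually_elim (simp add: Ints_mult)
    qed (use supp vec_support_zero in auto)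
    then show ?thesis
      using x z finite_subset[OF sup fin] by (auto simp: null_vecs_def)
  qed
  show ?thesis
  proof (rule submoduleI[OF _ zero])
    show "null_vecs \<subseteq> carrier P" by (auto simp: null_vecs_def)
    fix x assume x: "x \<in> null_vecs"
    have "(\<ominus>\<^bsub>Z\<^esub> \<one>\<^bsub>Z\<^esub>) \<odot>\<^bsub>P\<^esub> x \<in> null_vecs" by (rule smult[OF _ x]) simp
    then show "\<ominus>\<^bsub>P\<^esub> x \<in> null_vecs"
      using x by (simp add: smult_l_minus null_vecs_def)
  qed (use add smult in auto)
qed

lemma int_vec_add: "int_vec r p a k \<oplus>\<^bsub>P\<^esub> int_vec r p a l = int_vec r p a (\<lambda>s. k s + l s)"
  by (auto simp: add_P int_vec_def mod_simps intro!: restrict_ext)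

lemma int_vec_pow: "int_vec r p a k [^]\<^bsub>add_monoid P\<^esub> (m::nat) = int_vec r p a (\<lambda>s. int m * k s)"
  unfolding pow_P[OF int_vec_closed] by (auto simp: int_vec_def mod_simps intro!: restrict_ext)

lemma P_basis_eq_int_vec: "P_basis r p a s = int_vec r p a (\<lambda>t. if t = s then 1 else 0)"
  by (auto simp: basis_vec_def int_vec_def padic_int_simps intro!: restrict_ext)

text \<open>Both kinds of generators become integer vectors, on which functionals are evaluated by
  \<open>annihilates_int_vec\<close>.\<close>

lemma R_gen_eq:
  "R_gen r p a s = int_vec r p a
     (\<lambda>t. (if t = s then int p else 0) - (if length s \<noteq> 1 \<and> t = tl s then 1 else 0))"
proof (cases "length s = 1")
  case True
  then show ?thesis
    unfolding R_gen_def add_pow_def P_basis_eq_int_vec int_vec_pow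
    by (auto intro!: arg_cong[of _ _ "int_vec r p a"])
next
  case False
  interpret module Z P by (rule P_module)
  let ?w = "int_vec r p a (\<lambda>t. (if t = s then int p else 0) - (if t = tl s then 1 else 0))"
  have *: "?w \<oplus>\<^bsub>P\<^esub> P_basis r p a (tl s) = P_basis r p a s [^]\<^bsub>add_monoid P\<^esub> p"
    unfolding P_basis_eq_int_vec int_vec_add int_vec_pow by (auto intro!: arg_cong[of _ _ "int_vec r p a"])
  have B: "P_basis r p a (tl s) \<in> carrier P" unfolding P_basis_eq_int_vec by (rule int_vec_closed)
  have "R_gen r p a s = (?w \<oplus>\<^bsub>P\<^esub> P_basis r p a (tl s)) \<ominus>\<^bsub>P\<^esub> P_basis r p a (tl s)"
    using False by (simp add: R_gen_def add_pow_def *)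
  also have "\<dots> = ?w"
    using B int_vec_closed by (simp add: a_minus_def M.add.m_assoc M.r_neg)
  finally show ?thesis using False by simp
qed

lemma R_sub_subset: "R_sub r p a \<subseteq> null_vecs"
proof -
  have "R_gen r p a s \<in> null_vecs" if s: "s \<in> I" for s
  proof -
    obtain b t where bt: "s = b # t" using s by (cases s) (auto simp: diamond_def)
    let ?k = "\<lambda>t. (if t = s then int p else 0) - (if length s \<noteq> 1 \<and> t = tl s then 1 else 0)"
    \<comment> \<open>The empty list is not an index, so it is left out of \<open>T\<close>. Since
      \<phi> is 0 there, the sum is p \<phi>(b # t) - \<phi>(t) in both cases, and this is integral
      by compatibility.\<close>
    define T where "T = (if t = [] then {s} else {s, t})"
    have T: "finite T" "{u \<in> I. ?k u \<noteq> 0} \<subseteq> T" "T \<subseteq> I"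
      using s diamond_Cons(2)[of b t r a] by (auto simp: T_def bt split: if_splits)
    have "(\<Sum>u\<in>T. real_of_int (?k u) * \<phi> u) = real p * \<phi> (b # t) - \<phi> t" if "compatible r p a \<phi>" for \<phi>
      using that by (auto simp: T_def bt compatible_def)
    then have "annihilates r a \<phi> (int_vec r p a ?k)" if \<phi>: "compatible r p a \<phi>" for \<phi>
      using annihilates_int_vec[OF \<phi> T] \<phi> s bt by (auto simp: compatible_def)
    moreover have "finite (vec_support r a (int_vec r p a ?k))"
      using finite_subset[OF subset_trans[OF vec_support_int_vec T(2)] T(1)] .
    ultimately show ?thesis
      unfolding R_gen_eq by (simp add: null_vecs_def int_vec_closed)
  qed
  then show ?thesis
    unfolding R_sub_def submodule_span_def using null_vecs_submodule by blast
qed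

lemma R_gen_in_R_sub: "s \<in> I \<Longrightarrow> R_gen r p a s \<in> R_sub r p a"
  by (auto simp: R_sub_def submodule_span_def)

section \<open>Modifying a functional outside a set of ordinals\<close>

text \<open>The purpose is a functional \<psi> that agrees with \<phi> on sequences from
  \<open>U\<close> and for which p \<psi> vanishes from \<open>d\<close>. Outside \<open>U\<close>,
  sequences starting above \<open>d\<close> get 0, and the others get a quotient by \<open>p\<close>
  that satisfies the relation exactly. For this to be consistent, \<phi> must be integral on
  sequences that start in \<open>U\<close> above \<open>d\<close>.\<close>

fun extend_functional :: "('o list \<Rightarrow> real) \<Rightarrow> 'o set \<Rightarrow> 'o \<Rightarrow> 'o list \<Rightarrow> real" where
  "extend_functional \<phi> U d [] = 0"
| "extend_functional \<phi> U d (b # s) =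
     (if set (b # s) \<subseteq> U then \<phi> (b # s)
      else if (b, d) \<notin> r then 0 else extend_functional \<phi> U d s / real p)"

context
  fixes \<phi> :: "'o list \<Rightarrow> real" and U :: "'o set" and d :: 'o
  assumes \<phi>: "compatible r p a \<phi>"
    and U: "\<And>b s. b # s \<in> I \<Longrightarrow> b \<in> U \<Longrightarrow> (b, d) \<notin> r \<Longrightarrow> \<phi> (b # s) \<in> \<int>"
begin

private abbreviation "\<psi> \<equiv> extend_functional \<phi> U d"

lemma extend_functional_eq: "set s \<subseteq> U \<Longrightarrow> \<psi> s = \<phi> s"
  using \<phi> by (cases s) (auto simp: compatible_def)

lemma extend_functional_above: "b # s \<in> I \<Longrightarrow> (b, d) \<notin> r \<Longrightarrow> \<psi> (b # s) \<in> \<int>"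
  using U by auto

text \<open>Entries increase strictly: if the first one is at least \<open>d\<close>, a nonempty
  tail starts above \<open>d\<close>, where \<psi> is integral.\<close>

lemma extend_functional_tl:
  assumes bs: "b # s \<in> I" and b: "(b, d) \<notin> r \<or> (d, b) \<in> r"
  shows "\<psi> s \<in> \<int>"
proof (cases s)
  case (Cons c t)
  then have bc: "b \<in> underS c" using diamond_Cons_Cons[of b c t r a] bs by simp
  have ct: "c # t \<in> I" using diamond_Cons(2)[OF bs] Cons by simp
  have "(c, d) \<notin> r"
  proof
    assume cd: "(c, d) \<in> r"
    have "(b, d) \<in> r" using bc cd TRANS by (auto simp: underS_def dest: transD)
    then have "(d, b) \<in> r" using b by blast
    then have "(c, b) \<in> r" using cd TRANS by (meson transD)
    then show False using underS_imp_not_le[OF wo bc] by blast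
  qed
  then show ?thesis unfolding Cons by (rule extend_functional_above[OF ct])
qed simp

text \<open>Inside \<open>U\<close> the relation is inherited from \<phi>, as tails stay inside
  \<open>U\<close>. Outside, either the value is 0 and the tail has an integral value, or the value
  was defined by division by \<open>p\<close>.\<close>

lemma compatible_extend_functional: "compatible r p a \<psi>"
  unfolding compatible_def
proof (intro conjI allI impI)
  fix b s assume bs: "b # s \<in> I"
  consider "set (b # s) \<subseteq> U" | "\<not> set (b # s) \<subseteq> U" "(b, d) \<notin> r"
    | "\<not> set (b # s) \<subseteq> U" "(b, d) \<in> r" by blast
  then show "real p * \<psi> (b # s) - \<psi> s \<in> \<int>"
  proof cases
    case 1
    then have "set s \<subseteq> U" by simp
    then show ?thesis
      using extend_functional_eq[OF 1] extend_functional_eq[of s] \<phi> bs by (simp add: compatible_def)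
  next
    case 2
    then have "\<psi> (b # s) = 0" by (simp only: extend_functional.simps if_False) simp
    then show ?thesis using extend_functional_tl[OF bs] 2 by simp
  next
    case 3
    then have "\<psi> (b # s) = \<psi> s / real p" by (simp only: extend_functional.simps if_False) simp
    then show ?thesis using p by simp
  qed
qed simp

lemma compatible_mult_extend_functional: "compatible r p a (\<lambda>s. real p * \<psi> s)"
  unfolding compatible_def
proof (intro conjI allI impI)
  fix b s assume "b # s \<in> I"
  then have "real p * (real p * \<psi> (b # s) - \<psi> s) \<in> \<int>"
    using compatible_extend_functional by (intro Ints_mult) (auto simp: compatible_def)
  then show "real p * (real p * \<psi> (b # s)) - real p * \<psi> s \<in> \<int>"
    by (simp add: algebra_simps)
qed simp

text \<open>Modulo integers p \<psi>(b # s) equals \<psi>(s), and for b \<ge> d the latter is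
  integral because the tail starts above \<open>d\<close>.\<close>

lemma vanishes_from_mult_extend_functional: "vanishes_from r a d (\<lambda>s. real p * \<psi> s)"
  unfolding vanishes_from_def
proof (intro allI impI)
  fix b s assume bs: "b # s \<in> I" and db: "(d, b) \<in> r"
  have "real p * \<psi> (b # s) - \<psi> s \<in> \<int>"
    using compatible_extend_functional bs by (simp add: compatible_def)
  moreover have "\<psi> s \<in> \<int>" using extend_functional_tl[OF bs] db by simp
  ultimately have "(real p * \<psi> (b # s) - \<psi> s) + \<psi> s \<in> \<int>" by (rule Ints_add)
  then show "real p * \<psi> (b # s) \<in> \<int>" by simp
qed

end

section \<open>Basis vectors and the subgroups \<open>p^b D\<close>\<close>

lemma P_comm_group: "comm_group (add_monoid P)"
proof -
  interpret module Z P by (rule P_module)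
  show ?thesis by (rule a_comm_group)
qed

lemma R_subgroup: "subgroup (R_sub r p a) (add_monoid P)"
  by (rule submodule.axioms(1)[OF R_sub_submodule]) (use p in simp)

lemma D_grp_eq: "D_grp r p a = add_monoid P Mod R_sub r p a"
  by (simp add: D_grp_def A_FactGroup_def)

lemma D_comm_group: "comm_group (D_grp r p a)"
  using p by (intro D_grp_comm_group) simp

private abbreviation coset where
  "coset x \<equiv> R_sub r p a #>\<^bsub>add_monoid P\<^esub> x"

lemma coset_closed: "x \<in> carrier P \<Longrightarrow> coset x \<in> carrier (D_grp r p a)"
  by (auto simp: D_grp_eq carrier_FactGroup)

lemma coset_pow: "x \<in> carrier P \<Longrightarrow>
  coset x [^]\<^bsub>D_grp r p a\<^esub> (k::nat) = coset (x [^]\<^bsub>add_monoid P\<^esub> k)"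
proof -
  interpret comm_group "add_monoid P" by (rule P_comm_group)
  interpret normal "R_sub r p a" "add_monoid P" using R_subgroup by (simp add: normal_iff_subgroup)
  assume "x \<in> carrier P"
  then show ?thesis unfolding D_grp_eq by (intro FactGroup_pow) simp
qed

text \<open>\<open>D\<^sub>\<alpha>\<close> is an extension of \<open>P'\<^sub>\<alpha>/R\<^sub>\<alpha>\<close> by the torsion-free group \<open>P\<^sub>\<alpha>/P'\<^sub>\<alpha>\<close>, so a \<open>p\<close>-th root in \<open>D\<^sub>\<alpha>\<close> of a finitely
  supported element is finitely supported.  To pass from \<open>\<beta>\<close> to the largest relevant \<open>\<delta> < \<beta>\<close>, the
  functional is modified outside the finitely many ordinals that occur in the element.\<close>

lemma annihilates_of_iter_power:
  assumes "b \<in> Field r" "x \<in> carrier P" "finite (vec_support r a x)"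
    and "coset x \<in> iter_power r p (D_grp r p a) b"
    and "compatible r p a \<phi>" "vanishes_from r a b \<phi>"
  shows "annihilates r a \<phi> x"
  using assms
proof (induction b arbitrary: x \<phi> rule: well_order_induct)
  case (1 b)
  note bF = 1(2) and x = 1(3) and fin = 1(4) and mem = 1(5) and \<phi> = 1(6) and van = 1(7)
  have supI: "vec_support r a y \<subseteq> I" for y by (auto simp: vec_support_def)
  \<comment> \<open>\<open>U\<close> collects the ordinals occurring in \<open>x\<close>, and
    \<open>V\<close> those of them below \<open>b\<close>. If \<open>V\<close> is empty, \<phi> is
    integral on the whole support; otherwise the induction descends to the maximum \<open>d\<close>
    of \<open>V\<close>.\<close>
  define U where "U = (\<Union>s\<in>vec_support r a x. set s)"
  define V where "V = {u \<in> U. (b, u) \<notin> r}"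
  have "U \<subseteq> Field r"
    using supI[of x] by (fastforce simp: U_def diamond_def underS_def Field_def)
  then have UF: "V \<subseteq> Field r" by (auto simp: V_def)
  have finV: "finite V" using fin by (auto simp: V_def U_def)
  show ?case
  proof (cases "V = {}")
    case True
    have "\<phi> s \<in> \<int>" if s: "s \<in> vec_support r a x" for s
    proof -
      obtain c t where ct: "s = c # t" using s supI by (cases s) (auto simp: diamond_def vec_support_def)
      then have "c \<in> U" unfolding U_def using s by (intro UN_I[of s]) auto
      then have "(b, c) \<in> r" using True by (auto simp: V_def)
      then show ?thesis using van s supI ct by (auto simp: vanishes_from_def)
    qed
    then show ?thesis
      by (auto simp: annihilates_def intro!: always_eventually Ints_sum Ints_mult)
  next
    case False
    obtain d where d: "d \<in> V" "\<And>v. v \<in> V \<Longrightarrow> (v, d) \<in> r"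
      using finite_linear_max[OF wo finV False UF] by blast
    then have db: "d \<in> underS b"
      using not_le_imp_underS[OF wo bF] UF by (auto simp: V_def)
    \<comment> \<open>An ordinal of \<open>U\<close> above \<open>d\<close> is not in
      \<open>V\<close>, hence is at least \<open>b\<close>, and \<phi> vanishes from
      \<open>b\<close>.\<close>
    have U': "\<phi> (c # s) \<in> \<int>" if "c # s \<in> I" "c \<in> U" "(c, d) \<notin> r" for c s
      using that d(2) van by (auto simp: V_def vanishes_from_def)
    let ?\<psi> = "extend_functional \<phi> U d"
    obtain C where C: "C \<in> iter_power r p (D_grp r p a) d" "coset x = C [^]\<^bsub>D_grp r p a\<^esub> p"
      using mem db iter_power_iff[OF D_comm_group wo, of "coset x" p b] by blast
    then have "C \<in> carrier (D_grp r p a)" using iter_power_carrier[OF D_comm_group wo] by blast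
    then obtain y where y: "y \<in> carrier P" "C = coset y"
      by (auto simp: D_grp_eq carrier_FactGroup)
    interpret G: comm_group "add_monoid P" by (rule P_comm_group)
    have "x \<in> coset (y [^]\<^bsub>add_monoid P\<^esub> p)"
      using G.rcos_self[OF _ R_subgroup, of x] x C(2) coset_pow[OF y(1)] y(2) by simp
    then obtain h where h: "h \<in> R_sub r p a" "x = h \<oplus>\<^bsub>P\<^esub> y [^]\<^bsub>add_monoid P\<^esub> p"
      by (auto simp: r_coset_def)
    have xs: "x s n = (h s n + int p * y s n) mod int p ^ n" if "s \<in> I" for s n
      using that by (simp add: h(2) add_P pow_P[OF y(1)] mod_simps)
    have hN: "h \<in> null_vecs" using h(1) R_sub_subset by blast
    define T where "T = vec_support r a x \<union> vec_support r a h"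
    have T: "finite T" "T \<subseteq> I" using hN fin supI by (auto simp: T_def null_vecs_def)
    \<comment> \<open>The representative \<open>y\<close> was arbitrary, but outside
      \<open>T\<close> the coordinates of p y are 0, and the p-adic integers have no
      \<open>p\<close>-torsion.\<close>
    have ysup: "vec_support r a y \<subseteq> T"
    proof
      fix s assume s: "s \<in> vec_support r a y"
      show "s \<in> T"
      proof (rule ccontr)
        assume "s \<notin> T"
        moreover have sI: "s \<in> I" using s supI by blast
        ultimately have "x s = (\<lambda>n. 0)" "h s = (\<lambda>n. 0)" by (auto simp: T_def vec_support_def)
        then have "int p * y s n mod int p ^ n = 0" for n using xs[OF sI, of n] by simp
        moreover have "y s \<in> carrier Z" using y(1) sI by (auto simp: carrier_P)
        ultimately have "y s = (\<lambda>n. 0)" using p by (intro padic_int_torsion_free[of p]) simp_all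
        then show False using s by (simp add: vec_support_def)
      qed
    qed
    \<comment> \<open>The induction hypothesis at \<open>d\<close> is applied to p \<psi>, which
      vanishes from \<open>d\<close>; \<psi> itself need not do so.\<close>
    have "annihilates r a (\<lambda>s. real p * ?\<psi> s) y"
    proof -
      have "d \<noteq> b" "(d, b) \<in> r" "d \<in> Field r" using db by (auto simp: underS_def Field_def)
      then show ?thesis
        using 1(1) y(1) finite_subset[OF ysup T(1)] C(1) y(2)
          compatible_mult_extend_functional[OF \<phi> U'] vanishes_from_mult_extend_functional[OF \<phi> U']
        by blast
    qed
    then have py: "\<forall>\<^sub>F N in sequentially. real_of_int (int p) * (\<Sum>s\<in>T. real_of_int (y s N) * ?\<psi> s) \<in> \<int>"
      unfolding annihilates_iff[OF T(1) ysup T(2)] by (simp add: sum_distrib_left algebra_simps)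
    \<comment> \<open>Here \<psi>(x) = \<psi>(h) + (p \<psi>)(y), and \<psi> kills the relation
      \<open>h\<close>.\<close>
    have "annihilates r a ?\<psi> x"
    proof (rule annihilates_lincomb[OF compatible_extend_functional[OF \<phi> U'] T(1) _ _ ysup T(2) _ _ py])
      show "x s n = (h s n + int p * y s n) mod int p ^ n" if "s \<in> T" for s n
        using xs that T(2) by blast
      show "annihilates r a ?\<psi> h"
        using hN compatible_extend_functional[OF \<phi> U'] by (simp add: null_vecs_def)
    qed (auto simp: T_def)
    moreover have "?\<psi> s = \<phi> s" if "s \<in> vec_support r a x" for s
      using that by (intro extend_functional_eq[OF \<phi> U']) (auto simp: U_def)
    ultimately show ?thesis using annihilates_cong by metis
  qed
qed

text \<open>For d < b the vector with \<open>d\<close> prepended is a root modulo the relations, and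
  it lies in \<open>p^d D\<close> by induction. Prepending is possible since d < b \<le> c.\<close>

lemma basis_in_iter_power:
  assumes "c # s \<in> I" "(b, c) \<in> r"
  shows "coset (P_basis r p a (c # s)) \<in> iter_power r p (D_grp r p a) b"
  using assms
proof (induction b arbitrary: c s rule: well_order_induct)
  case (1 b)
  interpret G: comm_group "add_monoid P" by (rule P_comm_group)
  have B: "P_basis r p a t \<in> carrier P" for t unfolding P_basis_eq_int_vec by (rule int_vec_closed)
  have "\<exists>C\<in>iter_power r p (D_grp r p a) d.
      coset (P_basis r p a (c # s)) = C [^]\<^bsub>D_grp r p a\<^esub> p" if d: "d \<in> underS b" for d
  proof
    have dF: "d \<noteq> b" "(d, b) \<in> r" "(d, d) \<in> r"
      using d REFL by (auto simp: underS_def Field_def refl_on_def)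
    have dc: "d \<in> underS c" using underS_mono[OF wo 1(3)] d by blast
    have "c \<in> underS a" using diamond_Cons(1)[OF 1(2)] .
    then have "d \<in> underS a" using underS_mono[OF wo] dc by (auto simp: underS_def)
    moreover have "(d, y) \<in> r \<and> d \<noteq> y" if "y \<in> set (c # s)" for y
    proof -
      have "(c, c) \<in> r" using dc REFL by (auto simp: underS_def Field_def refl_on_def)
      then have "(c, y) \<in> r" using 1(2) that by (auto simp: diamond_def)
      then show ?thesis using underS_mono[OF wo] dc by (fastforce simp: underS_def)
    qed
    ultimately have dcs: "d # c # s \<in> I" using 1(2) by (auto simp: diamond_def)
    show "coset (P_basis r p a (d # c # s)) \<in> iter_power r p (D_grp r p a) d"
      using 1(1) dF dcs by blast
    have "P_basis r p a (d # c # s) [^]\<^bsub>add_monoid P\<^esub> p =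
        R_gen r p a (d # c # s) \<oplus>\<^bsub>P\<^esub> P_basis r p a (c # s)"
      unfolding R_gen_eq P_basis_eq_int_vec int_vec_add int_vec_pow
      by (auto intro!: arg_cong[of _ _ "int_vec r p a"])
    then have "P_basis r p a (d # c # s) [^]\<^bsub>add_monoid P\<^esub> p \<in> coset (P_basis r p a (c # s))"
      using R_gen_in_R_sub[OF dcs] by (auto simp: r_coset_def)
    from G.repr_independence[OF this _ R_subgroup] B
    show "coset (P_basis r p a (c # s)) = coset (P_basis r p a (d # c # s)) [^]\<^bsub>D_grp r p a\<^esub> p"
      by (simp add: coset_pow)
  qed
  then show ?case
    using iter_power_iff[OF D_comm_group wo, of _ p b] coset_closed[OF B] by blast
qed

lemma basis_notin_iter_power:
  assumes aF: "a \<in> Field r" and c: "c \<in> underS a"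
  shows "coset (P_basis r p a [c]) \<notin> iter_power r p (D_grp r p a) a"
proof
  assume mem: "coset (P_basis r p a [c]) \<in> iter_power r p (D_grp r p a) a"
  \<comment> \<open>This functional takes the non-integral value 1/p at \<open>[c]\<close>. For
    one-term sequences the relation holds only modulo integers, since p times 1/p is 1.\<close>
  define \<phi> :: "'o list \<Rightarrow> real" where "\<phi> = (\<lambda>s. if s = [] then 0 else 1 / real p ^ length s)"
  have \<phi>: "compatible r p a \<phi>" using p by (auto simp: compatible_def \<phi>_def)
  \<comment> \<open>All entries of the sequences are below \<open>a\<close>, so the condition is
    vacuous.\<close>
  have van: "vanishes_from r a a \<phi>"
    unfolding vanishes_from_def using underS_imp_not_le[OF wo diamond_Cons(1)] by simp
  let ?k = "\<lambda>t. if t = [c] then 1 else 0"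
  have T: "finite {[c]}" "{s \<in> I. ?k s \<noteq> 0} \<subseteq> {[c]}" "{[c]} \<subseteq> I"
    using c by (auto simp: diamond_def)
  have "annihilates r a \<phi> (P_basis r p a [c])"
    using finite_subset[OF subset_trans[OF vec_support_int_vec T(2)] T(1)]
    by (intro annihilates_of_iter_power[OF aF _ _ mem \<phi> van])
      (auto simp: P_basis_eq_int_vec int_vec_closed)
  then have "(\<Sum>s\<in>{[c]}. real_of_int (?k s) * \<phi> s) \<in> \<int>"
    unfolding P_basis_eq_int_vec annihilates_int_vec[OF \<phi> T] .
  then have "1 / real p \<in> \<int>" by (simp add: \<phi>_def)
  then obtain z where z: "1 / real p = of_int z" by (rule Ints_cases)
  have "0 < 1 / real p" "1 / real p < 1" using p by auto
  then have "0 < z" "z < 1" unfolding z by auto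
  then show False by simp
qed

section \<open>Consequences for the groups E\<close>

lemma telescopic_E_grp: "telescopic p (E_grp r p a)"
proof -
  have "telescopic p (add_monoid P)"
    unfolding P_mod_def using p by (intro telescopic_power_module telescopic_padic_int) simp
  then have "telescopic p (D_grp r p a)"
    unfolding D_grp_eq by (intro telescopic_Mod P_comm_group R_subgroup)
  then show ?thesis
    unfolding E_grp_def
    by (intro telescopic_Mod D_comm_group subgroup_iter_power[OF D_comm_group wo])
qed

lemma iter_power_E_grp_trivial:
  "a \<in> Field r \<Longrightarrow> iter_power r p (E_grp r p a) a = {\<one>\<^bsub>E_grp r p a\<^esub>}"
  unfolding E_grp_def by (rule iter_power_Mod_self[OF D_comm_group wo])

lemma iter_power_E_grp_nontrivial:
  assumes aF: "a \<in> Field r" and c: "c \<in> underS a"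
  obtains x where "x \<in> iter_power r p (E_grp r p a) c" "x \<noteq> \<one>\<^bsub>E_grp r p a\<^esub>"
proof -
  let ?H = "iter_power r p (D_grp r p a) a" and ?e = "coset (P_basis r p a [c])"
  have H: "subgroup ?H (D_grp r p a)" by (rule subgroup_iter_power[OF D_comm_group wo])
  interpret comm_group "D_grp r p a" by (rule D_comm_group)
  have "c \<in> Field r" using c by (auto simp: underS_def Field_def)
  then have "(c, c) \<in> r" using REFL by (simp add: refl_on_def)
  moreover have "[c] \<in> I" using c by (auto simp: diamond_def)
  ultimately have e: "?e \<in> iter_power r p (D_grp r p a) c" by (intro basis_in_iter_power)
  then have "?e \<in> carrier (D_grp r p a)" using iter_power_carrier[OF D_comm_group wo] by blast
  then have "?H #>\<^bsub>D_grp r p a\<^esub> ?e \<noteq> ?H"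
    using basis_notin_iter_power[OF aF c] rcos_self[OF _ H] by metis
  moreover have "?H #>\<^bsub>D_grp r p a\<^esub> ?e \<in> iter_power r p (E_grp r p a) c"
    unfolding E_grp_def by (rule iter_power_Mod_image[OF D_comm_group wo H e])
  ultimately show thesis using that by (simp add: E_grp_def)
qed

end

section \<open>The countably supported product of the groups E\<close>

theorem corollary5p9:
  fixes p :: nat
    and A :: "(nat set \<Rightarrow> (nat set list \<Rightarrow> nat \<Rightarrow> int) set set) monoid"
  assumes "Factorial_Ring.prime p"
    and "A = supported_product aleph1 (Field aleph1) (\<lambda>a. E_grp aleph1 p (ord_suc aleph1 a))"
  shows "local_seq (power_seq p A)
    \<and> (\<forall>l :: 'l rel. limit_ordinal l \<and> \<not> l =o aleph1 \<longrightarrow> complete_seq l (power_seq p A))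
    \<and> \<not> complete_seq aleph1 (power_seq p A)"
proof -
  have p: "p > 1" using assms(1) by (rule prime_gt_1_nat)
  note wo = Well_order_aleph1
  interpret wo_rel aleph1 by (rule wo_rel.intro) (rule wo)
  define E where "E = (\<lambda>a. E_grp aleph1 p (ord_suc aleph1 a))"
  have A: "A = supported_product aleph1 (Field aleph1) E" by (simp add: assms(2) E_def)
  have suc: "a \<in> underS (suc {a})" "suc {a} \<in> Field aleph1" if a: "a \<in> Field aleph1" for a
  proof -
    obtain b where "a \<in> underS b"
      by (rule limit_ordinal_exists_greater[OF limit_ordinal_aleph1 a])
    from is_suc_of_ord_suc[OF wo this] show "a \<in> underS (suc {a})" unfolding is_suc_of_def by blast
    then show "suc {a} \<in> Field aleph1" by (auto simp: underS_def Field_def)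
  qed
  have E: "comm_group (E a)" for a
    unfolding E_def using p by (intro E_grp_comm_group wo) simp
  have triv: "iter_power aleph1 p (E a) (suc {a}) = {\<one>\<^bsub>E a\<^esub>}" if "a \<in> Field aleph1" for a
    unfolding E_def by (rule iter_power_E_grp_trivial[OF p wo suc(2)[OF that]])
  have G: "comm_group A" unfolding A by (rule comm_group_supported_product[OF E])
  interpret A: comm_group A by (rule G)
  note carrier_A = carrier_supported_product[of "Field aleph1" E, OF E, folded A]
    and mult_A = mult_supported_product[of "Field aleph1" E, OF E, folded A]
    and one_A = one_supported_product[of "Field aleph1" E, OF E, folded A]
    and iter_power_A = iter_power_supported_product_iff[of "Field aleph1" E, OF E, folded A]
  have tel: "telescopic p A"
    unfolding A by (rule telescopic_supported_product[OF E]) (simp add: E_def telescopic_E_grp[OF p wo])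
  have red: "power_reduced p A"
    unfolding A by (rule power_reduced_supported_product[OF E]) (rule power_reducedI[OF E wo triv])
  have "complete_seq l (power_seq p A)" if l: "limit_ordinal l" "\<not> l =o aleph1" for l :: "'l rel"
  proof -
    have wol: "Well_order l" using l(1) by (simp add: limit_ordinal_def)
    consider "l <o aleph1" | "aleph1 <o l"
      using ordLess_or_ordLeq[OF wol wo] ordLeq_iff_ordLess_or_ordIso ordIso_symmetric l(2) by blast
    then show ?thesis
    proof cases
      case 1
      from complete_power_seq_countable[OF G tel red l(1) countable_Field_of_less_aleph1[OF this]]
      show ?thesis .
    next
      case 2
      \<comment> \<open>All of \<open>aleph1\<close> is mapped increasingly below the single ordinal
        \<open>b\<close>. Hence \<open>p^b (E a)\<close> is contained in
        \<open>p^(a+1) (E a)\<close>, which is trivial, for all \<open>a\<close>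
        simultaneously.\<close>
      obtain f b where f: "b \<in> Field l" "\<And>a. a \<in> Field aleph1 \<Longrightarrow> f a \<in> Order_Relation.underS l b"
        "\<And>a c. c \<in> underS a \<Longrightarrow> f c \<in> Order_Relation.underS l (f a)"
        by (rule strict_mono_below_of_less[OF 2]) (rule that)
      have "g = \<one>\<^bsub>A\<^esub>" if g: "g \<in> iter_power l p A b" for g
      proof -
        have gA: "g \<in> carrier A" using g iter_power_carrier[OF G wol] by blast
        have "g a = \<one>\<^bsub>E a\<^esub>" if a: "a \<in> Field aleph1" for a
        proof -
          have "g a \<in> iter_power l p (E a) b" using g a iter_power_A[OF wol] by blast
          moreover have "(f (suc {a}), b) \<in> l" using f(2)[OF suc(2)[OF a]] by (simp add: underS_def)
          ultimately have "g a \<in> iter_power l p (E a) (f (suc {a}))"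
            using iter_power_antimono[OF E wol] by blast
          then have "g a \<in> iter_power aleph1 p (E a) (suc {a})"
            using iter_power_strict_mono_subset[of "E a" aleph1 l f, OF E wo wol f(3)] by blast
          then show ?thesis using triv[OF a] by blast
        qed
        then show ?thesis
          using gA by (auto simp: carrier_A PiE_def extensional_def fun_eq_iff one_A)
      qed
      moreover have "\<one>\<^bsub>A\<^esub> \<in> iter_power l p A b"
        by (rule subgroup.one_closed[OF subgroup_iter_power[OF G wol]])
      ultimately have "iter_power l p A b = {\<one>\<^bsub>A\<^esub>}" by blast
      then show ?thesis by (rule complete_power_seq_of_trivial[OF G wol f(1)])
    qed
  qed
  moreover have "\<not> complete_seq aleph1 (power_seq p A)"
  proof
    assume comp: "complete_seq aleph1 (power_seq p A)"
    let ?N = "iter_power aleph1 p A"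
    have "\<exists>x\<in>iter_power aleph1 p (E a) a. x \<noteq> \<one>\<^bsub>E a\<^esub>" if a: "a \<in> Field aleph1" for a
      using iter_power_E_grp_nontrivial[OF p wo suc(2)[OF a] suc(1)[OF a]] by (metis E_def)
    then obtain x where x: "\<And>a. a \<in> Field aleph1 \<Longrightarrow> x a \<in> iter_power aleph1 p (E a) a"
      "\<And>a. a \<in> Field aleph1 \<Longrightarrow> x a \<noteq> \<one>\<^bsub>E a\<^esub>" by metis
    have one: "\<one>\<^bsub>E a\<^esub> \<in> iter_power aleph1 p (E a) b" for a b
      by (rule subgroup.one_closed[OF subgroup_iter_power[OF E wo]])
    have xE: "x a \<in> carrier (E a)" if "a \<in> Field aleph1" for a
      using x(1)[OF that] iter_power_carrier[OF E wo] by blast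
    have oneE: "\<one>\<^bsub>E a\<^esub> \<in> carrier (E a)" for a using E by (simp add: comm_group.axioms group.is_monoid)
    \<comment> \<open>Restriction of the family \<open>x\<close> to the coordinates in
      \<open>K\<close>. It lies in \<open>A\<close> for countable \<open>K\<close>, whereas
      \<open>x\<close> itself has uncountable support.\<close>
    define cut where "cut K = (\<lambda>a\<in>Field aleph1. if a \<in> K then x a else \<one>\<^bsub>E a\<^esub>)" for K
    have cutA: "cut K \<in> carrier A" if "countable K" for K
    proof -
      have "countable {a \<in> Field aleph1. cut K a \<noteq> \<one>\<^bsub>E a\<^esub>}"
        by (rule countable_subset[OF _ that]) (auto simp: cut_def)
      then show ?thesis using xE oneE by (auto simp: carrier_A cut_def)
    qed
    \<comment> \<open>At a nontrivial coordinate \<open>a\<close> one has b \<le> a, so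
      \<open>x a\<close> lies in \<open>p^a (E a)\<close> and therefore in
      \<open>p^b (E a)\<close>.\<close>
    have cutN: "cut (underS c - underS b) \<in> ?N b" if b: "b \<in> Field aleph1" for b c
    proof -
      have "cut (underS c - underS b) a \<in> iter_power aleph1 p (E a) b" if a: "a \<in> Field aleph1" for a
      proof (cases "a \<in> underS c - underS b")
        case True
        then have "(b, a) \<in> aleph1" using not_le_imp_underS[OF wo b a] by blast
        then have "x a \<in> iter_power aleph1 p (E a) b"
          using x(1)[OF a] iter_power_antimono[OF E wo] by blast
        then show ?thesis using True a by (simp add: cut_def)
      qed (use a one in \<open>auto simp: cut_def\<close>)
      then show ?thesis
        using cutA[OF countable_Diff[OF countable_underS_aleph1]] iter_power_A[OF wo] by blast
    qed
    define T where "T c = cut (underS c)" for c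
    have TA: "T c \<in> carrier A" for c
      unfolding T_def by (rule cutA[OF countable_underS_aleph1])
    have Tcut: "T c = cut (underS c - underS b) \<otimes>\<^bsub>A\<^esub> T b" if bc: "(b, c) \<in> aleph1" for b c
    proof
      fix a
      show "T c a = (cut (underS c - underS b) \<otimes>\<^bsub>A\<^esub> T b) a"
      proof (cases "a \<in> Field aleph1")
        case True
        interpret E: comm_group "E a" by (rule E)
        show ?thesis
          using True xE[OF True] underS_mono[OF wo bc] by (auto simp: T_def cut_def mult_A)
      qed (simp add: T_def cut_def mult_A)
    qed
    \<comment> \<open>For b \<le> c the truncations \<open>T c\<close> and \<open>T b\<close> differ
      by an element of \<open>p^b A\<close>, so their cosets form a compatible family.\<close>
    have "\<exists>s\<in>carrier A. \<forall>b\<in>Field aleph1. ?N b #>\<^bsub>A\<^esub> T b = ?N b #>\<^bsub>A\<^esub> s"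
    proof (rule complete_power_seq_iff[OF G wo, THEN iffD1, OF comp, rule_format])
      show "?N b #>\<^bsub>A\<^esub> T b \<in> carrier (A Mod ?N b)" for b
        using TA by (auto simp: carrier_FactGroup)
      fix b c assume bc: "(b, c) \<in> aleph1"
      have "T c \<in> ?N b #>\<^bsub>A\<^esub> T b" 
        using Tcut[OF bc] cutN[of b c] bc by (auto simp: r_coset_def Field_def)
      from A.repr_independence[OF this TA subgroup_iter_power[OF G wo]]
      show "?N b <#>\<^bsub>A\<^esub> (?N c #>\<^bsub>A\<^esub> T c) = ?N b #>\<^bsub>A\<^esub> T b"
        using iter_power_mult_coset[OF G wo bc TA] by simp
    qed
    then obtain s where s: "s \<in> carrier A" "\<And>b. b \<in> Field aleph1 \<Longrightarrow> ?N b #>\<^bsub>A\<^esub> T b = ?N b #>\<^bsub>A\<^esub> s"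
      by blast
    \<comment> \<open>Comparison at index a + 1: there \<open>T\<close> already has the coordinate
      \<open>x a\<close>, and the error lies in \<open>p^(a+1) (E a)\<close>, which is trivial. So
      \<open>s\<close> agrees with \<open>x\<close> everywhere.\<close>
    have "s a \<noteq> \<one>\<^bsub>E a\<^esub>" if a: "a \<in> Field aleph1" for a
    proof -
      have "s \<in> ?N (suc {a}) #>\<^bsub>A\<^esub> T (suc {a})"
        using s(2)[OF suc(2)[OF a]] A.rcos_self[OF s(1) subgroup_iter_power[OF G wo]] by blast
      then obtain h where h: "h \<in> ?N (suc {a})" "s = h \<otimes>\<^bsub>A\<^esub> T (suc {a})"
        by (auto simp: r_coset_def)
      have "h a = \<one>\<^bsub>E a\<^esub>" using h(1) iter_power_A[OF wo] triv[OF a] a by blast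
      interpret E: comm_group "E a" by (rule E)
      have "s a = x a"
        using h(2) \<open>h a = _\<close> a suc(1)[OF a] xE[OF a] by (simp add: mult_A T_def cut_def)
      then show ?thesis using x(2)[OF a] by simp
    qed
    then have "{a \<in> Field aleph1. s a \<noteq> \<one>\<^bsub>E a\<^esub>} = Field aleph1" by blast
    then show False using s(1) uncountable_Field_aleph1 by (simp add: carrier_A)
  qed
  ultimately show ?thesis using local_power_seq[OF G tel red] by blast
qed

end
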